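(* Let $n\ge1$, let $\lambda$ be a partition with at most $n$ nonzero parts, let $T\in\mathrm{GT}(\lambda)$ and let $\mathrm{rsort}^{-1}(T)=\{F\in\mathrm{CSF}(\lambda):\mathrm{rsort}(F)=T\}$. Then (1) $\displaystyle\sum_{F\in\mathrm{rsort}^{-1}(T)}q^{\mathrm{inv}(F)}=\sum_{F\in\mathrm{rsort}^{-1}(T)}q^{\mathrm{quinv}(F)}=\mathrm{wt}_q(T)$; (2) $\mathrm{inv}(F)+\mathrm{quinv}(F)=\mathrm{area}(T)$ for all $F\in\mathrm{rsort}^{-1}(T)$; in particular the sum is constant on $\mathrm{rsort}^{-1}(T)$.
   Context: The Young diagram of $\lambda$ is $\mathrm{dg}(\lambda)=\{(r,c):1\le c\le\lambda_r\}$, with $r$ the row index from the top and $c$ the column index from the left. $\mathrm{CSF}(\lambda)$ is the set of column strict fillings: maps $F:\mathrm{dg}(\lambda)\to[n]=\{1,\dots,n\}$ strictly increasing down each column. For a cell $u=(i,j)$ with $i>1$ let $u^\uparrow=(i-1,j)$; $\mathrm{Des}(F)$ is the set of cells $u$ not in the first row with $F(u)>F(u^\uparrow)$; $\mathrm{arm}(u)$ is the number of cells of $\mathrm{dg}(\lambda)$ strictly to the right of $u$ in its row. A cell $u$ Inv-attacks $v$ if they are in the same row with $u$ strictly left of $v$, or $u$ is in the row immediately below that of $v$, in a column strictly to the right of that of $v$. A cell $u$ Quinv-attacks $v$ if they are in the same row with $u$ strictly right of $v$, or $u$ is in the row immediately below that of $v$, in a column strictly to the left of that of $v$. $\mathrm{Inv}(F)$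 (resp. $\mathrm{Quinv}(F)$) is the set of pairs $(u,v)$ such that $u$ Inv-attacks (resp. Quinv-attacks) $v$ and $F(u)>F(v)$. Then $\mathrm{inv}(F)=|\mathrm{Inv}(F)|-\sum_{u\in\mathrm{Des}(F)}\mathrm{arm}(u)$ and $\mathrm{quinv}(F)=|\mathrm{Quinv}(F)|-\sum_{u\in\mathrm{Des}(F)}\mathrm{arm}(u^\uparrow)$. $\mathrm{GT}(\lambda)$ is the set of Gelfand-Tsetlin patterns: integer arrays $T=(T^j_i:1\le i\le j\le n)$ with $T^n_i=\lambda_i$ and, for $1\le i\le j<n$, $\mathrm{NE}_{ij}(T):=T^{j+1}_i-T^j_i\ge0$ and $\mathrm{SE}_{ij}(T):=T^j_i-T^{j+1}_{i+1}\ge0$. It is identified with the set of semistandard Young tableaux of shape $\lambda$ with entries in $[n]$ by letting $T^j_i$ be the number of cells of the $i$th row containing entries $\le j$. $\mathrm{rsort}(F)$ is obtained from $F$ by sorting the entries of each row in ascending order from left to right; it is a semistandard tableau, regarded as an element of $\mathrm{GT}(\lambda)$. With ${a\brack b}_q$ the $q$-binomial coefficient, $\mathrm{wt}_q(T)=\prod_{1\le i\le j<n}{\mathrm{NE}_{ij}(T)+\mathrm{SE}_{ij}(T)\brack\mathrm{NE}_{ij}(T)}_q$. Also $\mathrm{area}(T)=\sum_{1\le i\le j<n}\mathrm{NE}_{ij}(T)\,\mathrm{SE}_{ij}(T)$. *)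

theory Defs
  imports
    "HOL-Library.FuncSet"
    "HOL-Computational_Algebra.Formal_Laurent_Series"
begin

text \<open>
  A partition is a function with parts \<open>lam 1 \<ge> lam 2 \<ge> \<dots>\<close>;
  the value \<open>lam 0\<close> plays no role anywhere. Cells are pairs \<open>(row, column)\<close>,
  both counted from 1, with row 1 at the top.
\<close>

definition is_partition :: "(nat \<Rightarrow> nat) \<Rightarrow> bool" where
  "is_partition lam \<longleftrightarrow>
     (\<forall>i\<ge>1. lam (Suc i) \<le> lam i) \<and> finite {i. 1 \<le> i \<and> lam i \<noteq> 0}"

definition num_parts :: "(nat \<Rightarrow> nat) \<Rightarrow> nat" where
  "num_parts lam = card {i. 1 \<le> i \<and> lam i \<noteq> 0}"

type_synonym cell = "nat \<times> nat"
type_synonym filling = "cell \<Rightarrow> nat"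

definition dg :: "(nat \<Rightarrow> nat) \<Rightarrow> cell set" where
  "dg lam = {(r, c). 1 \<le> r \<and> 1 \<le> c \<and> c \<le> lam r}"

text \<open>Fillings are extensional functions, so that sums over sets of fillings count each filling once.\<close>

definition CSF :: "nat \<Rightarrow> (nat \<Rightarrow> nat) \<Rightarrow> filling set" where
  "CSF n lam = {F \<in> dg lam \<rightarrow>\<^sub>E {1..n}.
     \<forall>r r' c. (r, c) \<in> dg lam \<and> (r', c) \<in> dg lam \<and> r < r' \<longrightarrow> F (r, c) < F (r', c)}"

fun up :: "cell \<Rightarrow> cell" where
  "up (i, j) = (i - 1, j)"

definition Des :: "(nat \<Rightarrow> nat) \<Rightarrow> filling \<Rightarrow> cell set" where
  "Des lam F = {u \<in> dg lam. fst u > 1 \<and> F u > F (up u)}"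

definition arm :: "(nat \<Rightarrow> nat) \<Rightarrow> cell \<Rightarrow> nat" where
  "arm lam u = card {v \<in> dg lam. fst v = fst u \<and> snd v > snd u}"

fun inv_attacks :: "cell \<Rightarrow> cell \<Rightarrow> bool" where
  "inv_attacks (i, j) (i', j') \<longleftrightarrow> (i = i' \<and> j < j') \<or> (i = i' + 1 \<and> j > j')"

fun quinv_attacks :: "cell \<Rightarrow> cell \<Rightarrow> bool" where
  "quinv_attacks (i, j) (i', j') \<longleftrightarrow> (i = i' \<and> j > j') \<or> (i = i' + 1 \<and> j < j')"

definition Inv_pairs :: "(nat \<Rightarrow> nat) \<Rightarrow> filling \<Rightarrow> (cell \<times> cell) set" where
  "Inv_pairs lam F = {(u, v). u \<in> dg lam \<and> v \<in> dg lam \<and> inv_attacks u v \<and> F u > F v}"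

definition Quinv_pairs :: "(nat \<Rightarrow> nat) \<Rightarrow> filling \<Rightarrow> (cell \<times> cell) set" where
  "Quinv_pairs lam F = {(u, v). u \<in> dg lam \<and> v \<in> dg lam \<and> quinv_attacks u v \<and> F u > F v}"

definition inv_stat :: "(nat \<Rightarrow> nat) \<Rightarrow> filling \<Rightarrow> int" where
  "inv_stat lam F = int (card (Inv_pairs lam F)) - (\<Sum>u\<in>Des lam F. int (arm lam u))"

definition quinv_stat :: "(nat \<Rightarrow> nat) \<Rightarrow> filling \<Rightarrow> int" where
  "quinv_stat lam F = int (card (Quinv_pairs lam F)) - (\<Sum>u\<in>Des lam F. int (arm lam (up u)))"

text \<open>
  The entry \<open>T\<^sup>j\<^sub>i\<close> of a pattern is \<open>T (i, j)\<close>, lower index first.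
  Patterns are extensional, so that equality of patterns is equality of the triangular arrays.
\<close>

type_synonym pattern = "nat \<times> nat \<Rightarrow> int"

definition gt_index :: "nat \<Rightarrow> (nat \<times> nat) set" where
  "gt_index n = {(i, j). 1 \<le> i \<and> i \<le> j \<and> j \<le> n}"

definition NE :: "pattern \<Rightarrow> nat \<Rightarrow> nat \<Rightarrow> int" where
  "NE T i j = T (i, j + 1) - T (i, j)"

definition SE :: "pattern \<Rightarrow> nat \<Rightarrow> nat \<Rightarrow> int" where
  "SE T i j = T (i, j) - T (i + 1, j + 1)"

definition GT :: "nat \<Rightarrow> (nat \<Rightarrow> nat) \<Rightarrow> pattern set" where
  "GT n lam = {T \<in> extensional (gt_index n).
     (\<forall>i\<in>{1..n}. T (i, n) = int (lam i)) \<and>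
     (\<forall>i j. 1 \<le> i \<and> i \<le> j \<and> j < n \<longrightarrow> NE T i j \<ge> 0 \<and> SE T i j \<ge> 0)}"

definition row_list :: "(nat \<Rightarrow> nat) \<Rightarrow> filling \<Rightarrow> nat \<Rightarrow> nat list" where
  "row_list lam F r = map (\<lambda>c. F (r, c)) [1..<lam r + 1]"

definition rsort :: "(nat \<Rightarrow> nat) \<Rightarrow> filling \<Rightarrow> filling" where
  "rsort lam F = restrict (\<lambda>(r, c). sort (row_list lam F r) ! (c - 1)) (dg lam)"

definition tableau_to_gt :: "nat \<Rightarrow> (nat \<Rightarrow> nat) \<Rightarrow> filling \<Rightarrow> pattern" where
  "tableau_to_gt n lam S =
     restrict (\<lambda>(i, j). int (card {c. (i, c) \<in> dg lam \<and> S (i, c) \<le> j})) (gt_index n)"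

definition rsort_fibre :: "nat \<Rightarrow> (nat \<Rightarrow> nat) \<Rightarrow> pattern \<Rightarrow> filling set" where
  "rsort_fibre n lam T = {F \<in> CSF n lam. tableau_to_gt n lam (rsort lam F) = T}"

text \<open>
  The statistics are integers defined by subtraction, so \<open>q\<close> is taken to be the indeterminate of the
  field of formal Laurent series over the rationals, which contains all Laurent polynomials in
  \<open>q\<close> with integer coefficients. No quantum integer \<open>[k]\<^sub>q\<close> with \<open>k \<ge> 1\<close> vanishes there, so the
  quotient below is a genuine one.
\<close>

abbreviation qvar :: "rat fls" where
  "qvar \<equiv> fls_X"

definition qint :: "nat \<Rightarrow> rat fls" where
  "qint k = (\<Sum>i<k. qvar ^ i)"

definition qfact :: "nat \<Rightarrow> rat fls" where
  "qfact m = (\<Prod>k=1..m. qint k)"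

definition qbinomial :: "nat \<Rightarrow> nat \<Rightarrow> rat fls" where
  "qbinomial a b = (if b \<le> a then qfact a / (qfact b * qfact (a - b)) else 0)"

text \<open>On patterns in \<open>GT\<close> the differences \<open>NE\<close> and \<open>SE\<close> are nonnegative, so \<open>nat\<close> loses nothing.\<close>

definition wt_q :: "nat \<Rightarrow> pattern \<Rightarrow> rat fls" where
  "wt_q n T = (\<Prod>(i, j)\<in>{(i, j). 1 \<le> i \<and> i \<le> j \<and> j < n}.
     qbinomial (nat (NE T i j + SE T i j)) (nat (NE T i j)))"

definition area :: "nat \<Rightarrow> pattern \<Rightarrow> int" where
  "area n T = (\<Sum>(i, j)\<in>{(i, j). 1 \<le> i \<and> i \<le> j \<and> j < n}. NE T i j * SE T i j)"

end

theory Submission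
  imports Defs
begin

text \<open>
  Reading a column strict filling \<open>F\<close> one value \<open>k = 1, \<dots>, n\<close> at a time, a column grows
  by one cell whenever it contains \<open>k\<close>. Fixing \<open>rsort F\<close> means fixing, for every \<open>k\<close>, how many columns
  have each height: at time \<open>k\<close>, of the columns that then have height \<open>i\<close>, exactly
  \<open>NE T i (k - 1)\<close> have just grown and \<open>SE T i (k - 1)\<close> have not.

  Since every cell below the first row is a descent, \<open>quinv F\<close> counts the pairs of columns of equal
  height after step \<open>k\<close> of which only the right one has just grown. Choosing the
  growing columns backwards from \<open>k = n\<close>, each height contributes a q-binomial
  coefficient, which gives \<open>wt_q T\<close>. Similarly \<open>inv F\<close> counts the pairs of equal height before
  step \<open>k\<close> of which only the right one grows. As the final heights decrease from left to right,
  every such overtaking is undone, so \<open>inv F\<close> also counts the pairs of equal height after step \<open>k\<close>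
  of which only the left one has just grown. Thus \<open>inv\<close> has the same generating function by reversing
  the order of the columns, and \<open>inv F + quinv F\<close> counts all pairs of a column
  that has grown and one that has not, which is \<open>area T\<close>.
\<close>

section \<open>Subsets and q-binomial coefficients\<close>

lemma qint_nonzero:
  assumes "k \<ge> 1"
  shows "qint k \<noteq> 0"
proof -
  have "fls_nth (qint k) 0 = (\<Sum>i<k. if i = 0 then 1 else 0)"
    unfolding qint_def by (simp add: fls_nth_sum fls_X_power_nth)
  also have "\<dots> = (1 :: rat)"
    using assms by simp
  finally show ?thesis by auto
qed

lemma qfact_nonzero: "qfact m \<noteq> 0"
  unfolding qfact_def by (simp add: qint_nonzero)

lemma qfact_Suc: "qfact (Suc m) = qfact m * qint (Suc m)"
  by (simp add: qfact_def)

lemma qint_add: "qint (m + k) = qvar ^ k * qint m + qint k"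
  by (induction m) (simp_all add: qint_def power_add algebra_simps)

lemma qbinomial_0: "qbinomial a 0 = 1"
  by (simp add: qbinomial_def qfact_nonzero qfact_def[of 0])

text \<open>The q-Pascal rule, in the variant that puts the power of \<open>qvar\<close> on the
  subsets containing the largest element. After clearing q-factorials it is \<open>qint_add\<close>
  for \<open>Suc a = Suc b + Suc d\<close>; the boundary case \<open>b = a\<close> relies on
  \<open>qbinomial a (Suc b) = 0\<close>.\<close>

lemma qbinomial_Suc_Suc:
  assumes "b \<le> a"
  shows "qbinomial (Suc a) (Suc b) = qvar ^ (a - b) * qbinomial a b + qbinomial a (Suc b)"
proof (cases "b = a")
  case True
  then show ?thesis
    by (simp add: qbinomial_def qfact_nonzero qfact_def[of 0])
next
  case False
  with assms obtain d where d: "a = b + Suc d"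
    by (metis add_Suc_right le_neq_implies_less less_iff_Suc_add)
  have "qint (Suc a) = qvar ^ Suc d * qint (Suc b) + qint (Suc d)"
    using qint_add[of "Suc b" "Suc d"] by (simp add: d)
  then show ?thesis
    using qfact_nonzero[of b] qfact_nonzero[of d] qint_nonzero[of "Suc d"] qint_nonzero[of "Suc b"]
    by (simp add: qbinomial_def d qfact_Suc field_simps)
qed

text \<open>List \<open>A\<close> in the order of \<open>f\<close> and write 1 for members of
  \<open>V\<close>, 0 for the others: these are the inversions of a 0-1 word, up to the direction of
  the order.\<close>

definition cross :: "(nat \<Rightarrow> int) \<Rightarrow> nat set \<Rightarrow> nat set \<Rightarrow> nat" where
  "cross f A V = card {(j, x). j \<in> A - V \<and> x \<in> V \<and> f j < f x}"

text \<open>Adjoin the \<open>f\<close>-largest element \<open>m\<close>. Outside the subset it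
  creates no pair; inside, it is paired with every element left outside. These two cases are the two
  terms of the q-Pascal rule.\<close>

lemma sum_cross_eq_qbinomial:
  assumes "finite A" "inj_on f A"
  shows "(\<Sum>V | V \<subseteq> A \<and> card V = b. qvar ^ cross f A V) = qbinomial (card A) b"
  using assms
proof (induction A arbitrary: b rule: finite_ranking_induct[where f = f])
  case empty
  have *: "{V. V \<subseteq> {} \<and> card V = b} = (if b = 0 then {{}} else {})"
    by auto
  show ?case
    unfolding * by (simp add: cross_def qbinomial_def qfact_def)
next
  case (insert m A)
  show ?case
  proof (cases "m \<in> A")
    case True
    then show ?thesis using insert by (simp add: insert_absorb)
  next
    case m: False
    \<comment> \<open>The ranking induction gives only \<le>; injectivity of \<open>f\<close> and
      \<open>m \<notin> A\<close> make it strict.\<close>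
    have top: "f y < f m" if "y \<in> A" for y
      using insert.hyps(2)[OF that] insert.prems that m
      by (metis inj_on_eq_iff insertCI order_le_less)
    have fin: "finite V" if "V \<subseteq> A" for V
      using that insert.hyps(1) finite_subset by blast
    have out: "cross f (insert m A) V = cross f A V" if "V \<subseteq> A" for V
    proof -
      have "{(j, x). j \<in> insert m A - V \<and> x \<in> V \<and> f j < f x} =
            {(j, x). j \<in> A - V \<and> x \<in> V \<and> f j < f x}"
        using that top by (fastforce dest: order.asym)
      then show ?thesis by (simp add: cross_def)
    qed
    have inn: "cross f (insert m A) (insert m V) = (card A - card V) + cross f A V"
      if V: "V \<subseteq> A" for V
    proof -
      have eq: "{(j, x). j \<in> insert m A - insert m V \<and> x \<in> insert m V \<and> f j < f x} =
            (\<lambda>j. (j, m)) ` (A - V) \<union> {(j, x). j \<in> A - V \<and> x \<in> V \<and> f j < f x}"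
        using V m top by auto
      have fin': "finite {(j, x). j \<in> A - V \<and> x \<in> V \<and> f j < f x}"
        by (rule finite_subset[of _ "A \<times> V"]) (use fin[OF V] insert.hyps(1) in auto)
      have "cross f (insert m A) (insert m V) =
          card ((\<lambda>j. (j, m)) ` (A - V)) + card {(j, x). j \<in> A - V \<and> x \<in> V \<and> f j < f x}"
        unfolding cross_def eq
        by (rule card_Un_disjoint) (use fin' insert.hyps(1) V m in auto)
      moreover have "card ((\<lambda>j. (j, m)) ` (A - V)) = card A - card V"
        using V fin[OF V] by (simp add: card_image inj_on_def card_Diff_subset)
      ultimately show ?thesis by (simp add: cross_def)
    qed
    have IH: "(\<Sum>V | V \<subseteq> A \<and> card V = b. qvar ^ cross f A V) = qbinomial (card A) b" for b
      using insert.IH insert.prems by (simp add: inj_on_insert)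
    show ?thesis
    proof (cases b)
      case 0
      have "{V. V \<subseteq> insert m A \<and> card V = b} = {{}}"
        using insert.hyps(1) 0 finite_subset[of _ "insert m A"] by auto
      then show ?thesis by (simp add: 0 qbinomial_0 cross_def)
    next
      case (Suc b')
      have split: "{V. V \<subseteq> insert m A \<and> card V = b} =
          insert m ` {V. V \<subseteq> A \<and> card V = b'} \<union> {V. V \<subseteq> A \<and> card V = b}" (is "?L = ?R")
      proof (intro equalityI subsetI)
        fix V assume V: "V \<in> ?L"
        show "V \<in> ?R"
        proof (cases "m \<in> V")
          case True
          have fV: "finite V" using V insert.hyps(1) finite_subset[of V "insert m A"] by auto
          have "V = insert m (V - {m})" "V - {m} \<subseteq> A" "card (V - {m}) = b'"
            using V True fV Suc by auto
          then show ?thesis by blast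
        qed (use V in auto)
      next
        fix V assume "V \<in> ?R"
        then show "V \<in> ?L"
          using m Suc fin by (auto simp: card_insert_if)
      qed
      have inj: "inj_on (insert m) {V. V \<subseteq> A \<and> card V = b'}"
        using m by (auto simp: inj_on_def)
      have "(\<Sum>V | V \<subseteq> insert m A \<and> card V = b. qvar ^ cross f (insert m A) V) =
          (\<Sum>V \<in> insert m ` {V. V \<subseteq> A \<and> card V = b'}. qvar ^ cross f (insert m A) V) +
          (\<Sum>V | V \<subseteq> A \<and> card V = b. qvar ^ cross f (insert m A) V)"
        unfolding split
        by (rule sum.union_disjoint) (use m insert.hyps(1) in auto)
      also have "(\<Sum>V \<in> insert m ` {V. V \<subseteq> A \<and> card V = b'}. qvar ^ cross f (insert m A) V) =
          (\<Sum>V | V \<subseteq> A \<and> card V = b'. qvar ^ (card A - b') * qvar ^ cross f A V)"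
        by (simp add: sum.reindex[OF inj] inn power_add)
      also have "\<dots> = qvar ^ (card A - b') * qbinomial (card A) b'"
        by (simp add: IH flip: sum_distrib_left)
      also have "(\<Sum>V | V \<subseteq> A \<and> card V = b. qvar ^ cross f (insert m A) V) = qbinomial (card A) b"
        by (simp add: out IH)
      also have "qvar ^ (card A - b') * qbinomial (card A) b' + qbinomial (card A) b =
          qbinomial (Suc (card A)) b"
      proof (cases "b' \<le> card A")
        case True
        then show ?thesis by (simp add: Suc qbinomial_Suc_Suc)
      next
        \<comment> \<open>There are too few elements: all three q-binomials are 0 by the default
          branch of \<open>qbinomial\<close>.\<close>
        case False
        then show ?thesis by (simp add: Suc qbinomial_def)
      qed
      finally show ?thesis using m insert.hyps(1) by simp
    qed
  qed
qed

section \<open>Chains of column heights\<close>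

text \<open>
  A filling is encoded by the set \<open>P\<close> of pairs (value, column). The injection \<open>f\<close>
  orders the columns; it will be \<open>int\<close> or its negative, for \<open>quinv\<close> and \<open>inv\<close> respectively.
\<close>

definition height :: "(nat \<times> nat) set \<Rightarrow> nat \<Rightarrow> nat \<Rightarrow> nat" where
  "height P k c = card {m. m \<le> k \<and> (m, c) \<in> P}"

text \<open>\<open>H\<close> gives the heights after a step and \<open>U\<close> the columns that
  grow in it. For \<open>f = int\<close> only the right column of a counted pair has grown, for the
  negative of \<open>int\<close> only the left one.\<close>

definition step_inv :: "(nat \<Rightarrow> int) \<Rightarrow> nat set \<Rightarrow> (nat \<Rightarrow> nat) \<Rightarrow> nat set \<Rightarrow> nat" where
  "step_inv f C H U = card {(j, x). j \<in> C - U \<and> x \<in> C \<inter> U \<and> H j = H x \<and> f j < f x}"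

definition chain_inv :: "(nat \<Rightarrow> int) \<Rightarrow> nat set \<Rightarrow> nat \<Rightarrow> (nat \<times> nat) set \<Rightarrow> nat" where
  "chain_inv f C n P = (\<Sum>k=1..n. step_inv f C (height P k) {c. (k, c) \<in> P})"

text \<open>\<open>T (i, k)\<close> counts the entries at most \<open>k\<close> in row
  \<open>i\<close>, and each such entry belongs to a column of height at least \<open>i\<close> at
  time \<open>k\<close>. The final heights \<open>H\<close> are a separate argument because removing
  the last step changes them.\<close>

definition height_chains :: "nat \<Rightarrow> nat set \<Rightarrow> (nat \<Rightarrow> nat) \<Rightarrow> pattern \<Rightarrow> (nat \<times> nat) set set" where
  "height_chains n C H T = {P. P \<subseteq> {1..n} \<times> C \<and> (\<forall>c\<in>C. height P n c = H c) \<and>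
     (\<forall>(i, k)\<in>gt_index n. int (card {c \<in> C. i \<le> height P k c}) = T (i, k))}"

text \<open>The possible sets of columns containing the largest value \<open>n + 1\<close>.\<close>

definition steps :: "nat \<Rightarrow> nat set \<Rightarrow> (nat \<Rightarrow> nat) \<Rightarrow> pattern \<Rightarrow> nat set set" where
  "steps n C H T = {U. U \<subseteq> C \<and> (\<forall>c\<in>U. 1 \<le> H c) \<and> (\<forall>c\<in>C - U. H c \<le> n) \<and>
     (\<forall>i\<in>{1..n}. int (card {c \<in> C. i \<le> H c - of_bool (c \<in> U)}) = T (i, n))}"

section \<open>Elementary properties of heights\<close>

lemma height_Suc: "height P (Suc k) c = height P k c + of_bool ((Suc k, c) \<in> P)"
proof -
  have "{m. m \<le> Suc k \<and> (m, c) \<in> P} =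
      {m. m \<le> k \<and> (m, c) \<in> P} \<union> (if (Suc k, c) \<in> P then {Suc k} else {})"
    by (auto simp: le_Suc_eq)
  then show ?thesis by (auto simp: height_def)
qed

lemma height_0: "(0, c) \<notin> P \<Longrightarrow> height P 0 c = 0"
  by (simp add: height_def) (metis gr0I)

lemma height_le:
  assumes "(0, c) \<notin> P"
  shows "height P k c \<le> k"
  by (induction k) (auto simp: height_0 height_Suc assms)

lemma height_mono: "k \<le> l \<Longrightarrow> height P k c \<le> height P l c"
  unfolding height_def by (rule card_mono) auto

lemma height_cong:
  assumes "\<And>m. m \<le> k \<Longrightarrow> (m, c) \<in> P \<longleftrightarrow> (m, c) \<in> Q"
  shows "height P k c = height Q k c"
  unfolding height_def using assms by (intro arg_cong[where f = card] Collect_cong) blast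

lemma step_inv_cong:
  assumes "\<And>c. c \<in> C \<Longrightarrow> H c = H' c" "C \<inter> U = C \<inter> U'"
  shows "step_inv f C H U = step_inv f C H' U'"
proof -
  have "c \<in> U \<longleftrightarrow> c \<in> U'" if "c \<in> C" for c
    using assms(2) that by blast
  then have "{(j, x). j \<in> C - U \<and> x \<in> C \<inter> U \<and> H j = H x \<and> f j < f x} =
      {(j, x). j \<in> C - U' \<and> x \<in> C \<inter> U' \<and> H' j = H' x \<and> f j < f x}"
    using assms(1) by auto
  then show ?thesis by (simp add: step_inv_def)
qed

lemma finite_height_chains: "finite C \<Longrightarrow> finite (height_chains n C H T)"
  by (rule finite_subset[of _ "Pow ({1..n} \<times> C)"]) (auto simp: height_chains_def)

lemma finite_steps: "finite C \<Longrightarrow> finite (steps n C H T)"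
  by (rule finite_subset[of _ "Pow C"]) (auto simp: steps_def)

section \<open>Peeling off the largest value\<close>

text \<open>The columns containing \<open>Suc n\<close> lose one cell when that value is removed.
  Heights at times up to \<open>n\<close> depend only on the values up to \<open>n\<close>, so all
  earlier steps keep their contribution and only the last one splits off.\<close>

lemma height_chains_SucD:
  assumes "P \<in> height_chains (Suc n) C H T"
  defines "U \<equiv> {c. (Suc n, c) \<in> P}" and "P' \<equiv> P \<inter> {1..n} \<times> C"
  shows "U \<in> steps n C H T" "P' \<in> height_chains n C (\<lambda>c. H c - of_bool (c \<in> U)) T"
    "chain_inv f C (Suc n) P = chain_inv f C n P' + step_inv f C H U"
proof -
  have sub: "P \<subseteq> {1..Suc n} \<times> C" and hH: "\<And>c. c \<in> C \<Longrightarrow> height P (Suc n) c = H c"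
    and cT: "\<And>i k. (i, k) \<in> gt_index (Suc n) \<Longrightarrow> int (card {c \<in> C. i \<le> height P k c}) = T (i, k)"
    using assms(1) by (auto simp: height_chains_def)
  have h': "height P' k c = height P k c" if "k \<le> n" for k c
    by (rule height_cong) (use that sub in \<open>auto simp: P'_def\<close>)
  have z: "(0, c) \<notin> P" for c using sub by auto
  have hn: "H c - of_bool (c \<in> U) = height P n c" "H c = height P n c + of_bool (c \<in> U)"
    if "c \<in> C" for c
    using hH[OF that] by (auto simp: height_Suc U_def)
  show "U \<in> steps n C H T"
    unfolding steps_def
  proof (intro CollectI conjI ballI)
    show UC: "U \<subseteq> C" using sub by (auto simp: U_def)
    show "1 \<le> H c" if "c \<in> U" for c using hn(2)[of c] that UC by auto
    show "H c \<le> n" if "c \<in> C - U" for c using hn(2)[of c] that height_le[OF z] by auto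
    show "int (card {c \<in> C. i \<le> H c - of_bool (c \<in> U)}) = T (i, n)" if "i \<in> {1..n}" for i
      using cT[of i n] that hn(1) by (auto simp: gt_index_def cong: conj_cong)
  qed
  show "P' \<in> height_chains n C (\<lambda>c. H c - of_bool (c \<in> U)) T"
    unfolding height_chains_def
  proof (intro CollectI conjI ballI)
    show "P' \<subseteq> {1..n} \<times> C" by (auto simp: P'_def)
    show "height P' n c = H c - of_bool (c \<in> U)" if "c \<in> C" for c
      using hn(1)[OF that] by (simp add: h')
    show "case x of (i, k) \<Rightarrow> int (card {c \<in> C. i \<le> height P' k c}) = T (i, k)"
      if "x \<in> gt_index n" for x
      using cT that h' by (auto simp: gt_index_def)
  qed
  have "step_inv f C (height P' k) {c. (k, c) \<in> P'} = step_inv f C (height P k) {c. (k, c) \<in> P}"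
    if "k \<in> {1..n}" for k
    by (rule step_inv_cong) (use that h' in \<open>auto simp: P'_def\<close>)
  moreover have "step_inv f C (height P (Suc n)) {c. (Suc n, c) \<in> P} = step_inv f C H U"
    by (rule step_inv_cong) (use hH in \<open>auto simp: U_def\<close>)
  ultimately show "chain_inv f C (Suc n) P = chain_inv f C n P' + step_inv f C H U"
    by (simp add: chain_inv_def)
qed

text \<open>Splitting off the last step (\<open>J\<close>) and adjoining it again (\<open>K\<close>)
  are inverse bijections. The pattern conditions at time \<open>Suc n\<close> involve only the final
  heights, so they are supplied once and for all by \<open>top\<close>.\<close>

lemma sum_height_chains_Suc:
  assumes "finite C"
    and top: "\<forall>i\<in>{1..Suc n}. int (card {c \<in> C. i \<le> H c}) = T (i, Suc n)"
  shows "(\<Sum>P\<in>height_chains (Suc n) C H T. qvar ^ chain_inv f C (Suc n) P) =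
    (\<Sum>U\<in>steps n C H T. \<Sum>P\<in>height_chains n C (\<lambda>c. H c - of_bool (c \<in> U)) T.
       qvar ^ chain_inv f C n P * qvar ^ step_inv f C H U)"
proof -
  define J where "J = (\<lambda>P :: (nat \<times> nat) set. ({c. (Suc n, c) \<in> P}, P \<inter> {1..n} \<times> C))"
  define K where "K = (\<lambda>(U :: nat set, P :: (nat \<times> nat) set). P \<union> {Suc n} \<times> U)"
  let ?S = "Sigma (steps n C H T) (\<lambda>U. height_chains n C (\<lambda>c. H c - of_bool (c \<in> U)) T)"
  have KJ: "K (J P) = P" and JS: "J P \<in> ?S"
    and inv: "(case J P of (U, P') \<Rightarrow> qvar ^ chain_inv f C n P' * qvar ^ step_inv f C H U) =
      qvar ^ chain_inv f C (Suc n) P"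
    if P: "P \<in> height_chains (Suc n) C H T" for P
  proof -
    show "K (J P) = P"
      using P by (auto simp: J_def K_def height_chains_def le_Suc_eq)
    show "J P \<in> ?S"
      using height_chains_SucD(1,2)[OF P] by (simp add: J_def)
    show "(case J P of (U, P') \<Rightarrow> qvar ^ chain_inv f C n P' * qvar ^ step_inv f C H U) =
        qvar ^ chain_inv f C (Suc n) P"
      by (simp add: J_def height_chains_SucD(3)[OF P] power_add)
  qed
  have JK: "J (K x) = x" and KS: "K x \<in> height_chains (Suc n) C H T" if x: "x \<in> ?S" for x
  proof -
    obtain U P where x_eq: "x = (U, P)" by force
    have UC: "U \<subseteq> C" and U1: "\<And>c. c \<in> U \<Longrightarrow> 1 \<le> H c"
      and sub: "P \<subseteq> {1..n} \<times> C"
      and hP: "\<And>c. c \<in> C \<Longrightarrow> height P n c = H c - of_bool (c \<in> U)"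
      and cT: "\<And>i k. (i, k) \<in> gt_index n \<Longrightarrow> int (card {c \<in> C. i \<le> height P k c}) = T (i, k)"
      using x by (auto simp: x_eq height_chains_def steps_def)
    show "J (K x) = x"
      using sub UC by (auto simp: J_def K_def x_eq)
    have h: "height (K x) k c = height P k c" if "k \<le> n" for k c
      by (rule height_cong) (use that in \<open>auto simp: K_def x_eq\<close>)
    \<comment> \<open>\<open>1 \<le> H c\<close> on \<open>U\<close> ensures that the truncated
      subtraction \<open>H c - of_bool (c \<in> U)\<close> is undone by the added cell.\<close>
    have hS: "height (K x) (Suc n) c = H c" if "c \<in> C" for c
    proof -
      have "(Suc n, c) \<in> K x \<longleftrightarrow> c \<in> U" using sub by (auto simp: K_def x_eq)
      then show ?thesis
        using hP[OF that] U1[of c] by (auto simp: height_Suc h)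
    qed
    show "K x \<in> height_chains (Suc n) C H T"
      unfolding height_chains_def
    proof (intro CollectI conjI ballI)
      show "K x \<subseteq> {1..Suc n} \<times> C" using sub UC by (auto simp: K_def x_eq)
      show "height (K x) (Suc n) c = H c" if "c \<in> C" for c using hS that .
      show "case y of (i, k) \<Rightarrow> int (card {c \<in> C. i \<le> height (K x) k c}) = T (i, k)"
        if y_in: "y \<in> gt_index (Suc n)" for y
      proof -
        obtain i k where y: "y = (i, k)" by force
        consider "i \<in> {1..k}" "k \<le> n" | "k = Suc n" "i \<in> {1..Suc n}"
          using y_in by (fastforce simp: gt_index_def y le_Suc_eq)
        then show ?thesis
        proof cases
          case 1
          then show ?thesis using cT[of i k] h by (auto simp: y gt_index_def)
        next
          case 2
          then show ?thesis using top hS by (auto simp: y cong: conj_cong)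
        qed
      qed
    qed
  qed
  have "(\<Sum>P\<in>height_chains (Suc n) C H T. qvar ^ chain_inv f C (Suc n) P) =
     (\<Sum>(U, P)\<in>?S. qvar ^ chain_inv f C n P * qvar ^ step_inv f C H U)"
    by (rule sum.reindex_bij_witness[of _ K J]; fact KJ JS JK KS inv)
  also have "\<dots> = (\<Sum>U\<in>steps n C H T. \<Sum>P\<in>height_chains n C (\<lambda>c. H c - of_bool (c \<in> U)) T.
       qvar ^ chain_inv f C n P * qvar ^ step_inv f C H U)"
    by (rule sum.Sigma[symmetric]) (simp_all add: assms(1) finite_height_chains finite_steps)
  finally show ?thesis .
qed


section \<open>A single step, decomposed by column height\<close>

text \<open>The columns of height exactly \<open>i\<close> number
  \<open>T (i, Suc n) - T (Suc i, Suc n)\<close>; inserting \<open>T (i, n)\<close> between the two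
  entries splits this into \<open>NE\<close> and \<open>SE\<close>.\<close>

lemma card_level:
  assumes "finite C" "\<forall>i\<in>{1..Suc n}. int (card {c \<in> C. i \<le> H c}) = T (i, Suc n)"
    and "i \<in> {1..n}"
  shows "int (card {c \<in> C. H c = i}) = NE T i n + SE T i n"
proof -
  have "{c \<in> C. i \<le> H c} = {c \<in> C. H c = i} \<union> {c \<in> C. Suc i \<le> H c}" by auto
  then have "card {c \<in> C. i \<le> H c} = card {c \<in> C. H c = i} + card {c \<in> C. Suc i \<le> H c}"
    using assms(1) by (subst card_Un_disjoint[symmetric]) auto
  moreover have "int (card {c \<in> C. i \<le> H c}) = T (i, Suc n)"
    "int (card {c \<in> C. Suc i \<le> H c}) = T (Suc i, Suc n)"
    using assms(2,3) by auto
  ultimately show ?thesis by (simp add: NE_def SE_def)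
qed

text \<open>Losing one cell takes a column below height \<open>i\<close> only if its height was
  exactly \<open>i\<close>.\<close>

lemma card_level_step:
  fixes H :: "nat \<Rightarrow> nat"
  assumes "finite C" "1 \<le> i"
  shows "card {c \<in> C. i \<le> H c} =
    card {c \<in> C. i \<le> H c - of_bool (c \<in> U)} + card (U \<inter> {c \<in> C. H c = i})"
proof -
  have "{c \<in> C. i \<le> H c} =
      {c \<in> C. i \<le> H c - of_bool (c \<in> U)} \<union> (U \<inter> {c \<in> C. H c = i})"
    using assms(2) by (auto simp: of_bool_def split: if_splits)
  then show ?thesis
    using assms by (subst card_Un_disjoint[symmetric]) auto
qed

text \<open>The pattern conditions decouple into one condition per level: a subset of prescribed
  size on levels \<open>1..n\<close>, everything on level \<open>Suc n\<close>, nothing on level 0.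
  Hence a step is a family of independent choices.\<close>

lemma steps_iff:
  assumes "finite C" "\<forall>c\<in>C. H c \<le> Suc n"
    and top: "\<forall>i\<in>{1..Suc n}. int (card {c \<in> C. i \<le> H c}) = T (i, Suc n)"
  shows "U \<in> steps n C H T \<longleftrightarrow> U \<subseteq> C \<and> (\<forall>c\<in>U. 1 \<le> H c) \<and> {c \<in> C. H c = Suc n} \<subseteq> U \<and>
    (\<forall>i\<in>{1..n}. int (card (U \<inter> {c \<in> C. H c = i})) = NE T i n)"
proof -
  have "int (card {c \<in> C. i \<le> H c - of_bool (c \<in> U)}) = T (i, n) \<longleftrightarrow>
      int (card (U \<inter> {c \<in> C. H c = i})) = NE T i n" if i: "i \<in> {1..n}" for i
  proof -
    have "int (card {c \<in> C. i \<le> H c}) = T (i, Suc n)"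
      using i top by simp
    moreover have "card {c \<in> C. i \<le> H c} =
        card {c \<in> C. i \<le> H c - of_bool (c \<in> U)} + card (U \<inter> {c \<in> C. H c = i})"
      by (rule card_level_step) (use assms(1) i in auto)
    moreover have "NE T i n = T (i, Suc n) - T (i, n)"
      by (simp add: NE_def)
    ultimately show ?thesis
      by (intro iffI; linarith)
  qed
  moreover have "(\<forall>c\<in>C - U. H c \<le> n) \<longleftrightarrow> {c \<in> C. H c = Suc n} \<subseteq> U"
  proof -
    have "H c \<le> n \<longleftrightarrow> H c \<noteq> Suc n" if "c \<in> C" for c
      using assms(2) that by (auto simp: le_Suc_eq)
    then show ?thesis by auto
  qed
  ultimately show ?thesis by (simp add: steps_def)
qed

text \<open>Only columns of equal height are compared. Level 0 contains no grown column and no level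
  above \<open>n\<close> contains an ungrown one, so the levels \<open>1..n\<close> account for all
  pairs.\<close>

lemma step_inv_levels:
  assumes "finite C" "U \<subseteq> C" "\<forall>c\<in>U. 1 \<le> H c" "\<forall>c\<in>C - U. H c \<le> n"
  shows "step_inv f C H U = (\<Sum>i=1..n. cross f {c \<in> C. H c = i} (U \<inter> {c \<in> C. H c = i}))"
proof -
  let ?A = "\<lambda>i. {(j, x). j \<in> {c \<in> C. H c = i} - (U \<inter> {c \<in> C. H c = i}) \<and>
    x \<in> U \<inter> {c \<in> C. H c = i} \<and> f j < f x}"
  have "{(j, x). j \<in> C - U \<and> x \<in> C \<inter> U \<and> H j = H x \<and> f j < f x} = (\<Union>i\<in>{1..n}. ?A i)"
    (is "?L = ?R")
  proof (intro equalityI subsetI)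
    fix y assume "y \<in> ?L"
    then obtain j x where y: "y = (j, x)" "j \<in> C - U" "x \<in> C \<inter> U" "H j = H x" "f j < f x"
      by blast
    then have "1 \<le> H x" "H j \<le> n"
      using assms(3,4) by blast+
    with y have "H x \<in> {1..n}" "y \<in> ?A (H x)"
      by auto
    then show "y \<in> ?R" by blast
  qed auto
  moreover have "card (\<Union>i\<in>{1..n}. ?A i) = (\<Sum>i=1..n. card (?A i))"
  proof (rule card_UN_disjoint)
    show "\<forall>i\<in>{1..n}. finite (?A i)"
    proof
      fix i show "finite (?A i)"
        by (rule finite_subset[of _ "C \<times> C"]) (use assms(1) in auto)
    qed
  qed auto
  ultimately show ?thesis by (simp add: step_inv_def cross_def)
qed

text \<open>The choices on different levels are independent and the exponent is additive over
  levels, so the sum factors into one subset sum per level, each a q-binomial coefficient.\<close>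

lemma sum_steps:
  assumes "finite C" "inj f" "\<forall>c\<in>C. H c \<le> Suc n"
    and top: "\<forall>i\<in>{1..Suc n}. int (card {c \<in> C. i \<le> H c}) = T (i, Suc n)"
    and nonneg: "\<forall>i\<in>{1..n}. NE T i n \<ge> 0 \<and> SE T i n \<ge> 0"
  shows "(\<Sum>U\<in>steps n C H T. qvar ^ step_inv f C H U) =
    (\<Prod>i=1..n. qbinomial (nat (NE T i n + SE T i n)) (nat (NE T i n)))"
proof -
  define D where "D i = {c \<in> C. H c = i}" for i
  define B where "B i = {V. V \<subseteq> D i \<and> card V = nat (NE T i n)}" for i
  have finB: "finite (B i)" for i
    using assms(1) by (simp add: B_def D_def)
  have mem: "U \<in> steps n C H T \<longleftrightarrow> U \<subseteq> C \<and> (\<forall>c\<in>U. 1 \<le> H c) \<and> D (Suc n) \<subseteq> U \<and>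
      (\<forall>i\<in>{1..n}. card (U \<inter> D i) = nat (NE T i n))" for U
    unfolding steps_iff[OF assms(1,3) top] D_def using nonneg by fastforce
  have "(\<Sum>U\<in>steps n C H T. qvar ^ step_inv f C H U) =
      (\<Sum>g\<in>PiE {1..n} B. \<Prod>i=1..n. qvar ^ cross f (D i) (g i))"
  \<comment> \<open>A step is cut into its intersections with the levels \<open>1..n\<close>. Gluing
    must add level \<open>Suc n\<close>, where every column grows; on level 0 none does.\<close>
  proof (rule sum.reindex_bij_witness[where
        i = "\<lambda>g. D (Suc n) \<union> (\<Union>i\<in>{1..n}. g i)" and j = "\<lambda>U. \<lambda>i\<in>{1..n}. U \<inter> D i"])
    fix U assume U: "U \<in> steps n C H T"
    show "D (Suc n) \<union> (\<Union>i\<in>{1..n}. (\<lambda>i\<in>{1..n}. U \<inter> D i) i) = U"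
      using U assms(3) unfolding mem by (fastforce simp: D_def le_Suc_eq)
    show "(\<lambda>i\<in>{1..n}. U \<inter> D i) \<in> PiE {1..n} B"
      using U unfolding mem by (auto simp: B_def)
    have "step_inv f C H U = (\<Sum>i=1..n. cross f (D i) (U \<inter> D i))"
      unfolding D_def by (rule step_inv_levels) (use U assms(1) in \<open>auto simp: steps_def\<close>)
    then show "(\<Prod>i=1..n. qvar ^ cross f (D i) ((\<lambda>i\<in>{1..n}. U \<inter> D i) i)) =
        qvar ^ step_inv f C H U"
      by (simp add: power_sum)
  next
    fix g assume g: "g \<in> PiE {1..n} B"
    have gD: "g i \<subseteq> D i" if "i \<in> {1..n}" for i
      using PiE_mem[OF g that] by (simp add: B_def)
    have cap: "(D (Suc n) \<union> (\<Union>i\<in>{1..n}. g i)) \<inter> D i = g i" if "i \<in> {1..n}" for i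
      using gD that by (fastforce simp: D_def)
    show "(\<lambda>i\<in>{1..n}. (D (Suc n) \<union> (\<Union>i\<in>{1..n}. g i)) \<inter> D i) = g"
      using g cap by (auto simp: PiE_def extensional_def fun_eq_iff)
    show "D (Suc n) \<union> (\<Union>i\<in>{1..n}. g i) \<in> steps n C H T"
      unfolding mem
    proof (intro conjI ballI)
      show "D (Suc n) \<union> (\<Union>i\<in>{1..n}. g i) \<subseteq> C" using gD by (fastforce simp: D_def)
      show "1 \<le> H c" if "c \<in> D (Suc n) \<union> (\<Union>i\<in>{1..n}. g i)" for c
        using gD that by (fastforce simp: D_def)
      show "card ((D (Suc n) \<union> (\<Union>i\<in>{1..n}. g i)) \<inter> D i) = nat (NE T i n)"
        if "i \<in> {1..n}" for i
        unfolding cap[OF that] using PiE_mem[OF g that] by (simp add: B_def)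
    qed simp
  qed
  also have "\<dots> = (\<Prod>i=1..n. \<Sum>V\<in>B i. qvar ^ cross f (D i) V)"
    by (rule prod_sum_PiE[symmetric]) (use finB in auto)
  also have "\<dots> = (\<Prod>i=1..n. qbinomial (nat (NE T i n + SE T i n)) (nat (NE T i n)))"
  proof (rule prod.cong)
    fix i assume i: "i \<in> {1..n}"
    have "card (D i) = nat (NE T i n + SE T i n)"
      using card_level[OF assms(1) top i] by (simp add: D_def)
    moreover have "inj_on f (D i)" using assms(2) inj_on_subset by blast
    ultimately show "(\<Sum>V\<in>B i. qvar ^ cross f (D i) V) =
        qbinomial (nat (NE T i n + SE T i n)) (nat (NE T i n))"
      unfolding B_def using assms(1) sum_cross_eq_qbinomial[of "D i" f] by (simp add: D_def)
  qed simp
  finally show ?thesis .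
qed

section \<open>Assembling the steps: weight and area\<close>

lemma triangle_Suc:
  "{(i, j). 1 \<le> i \<and> i \<le> j \<and> j < Suc n} =
   {(i, j). 1 \<le> i \<and> i \<le> j \<and> j < n} \<union> (\<lambda>i. (i, n)) ` {1..n :: nat}"
  by auto

lemma finite_triangle: "finite {(i, j). 1 \<le> i \<and> i \<le> j \<and> j < (n :: nat)}"
  by (rule finite_subset[of _ "{..n} \<times> {..n}"]) auto

lemma wt_q_Suc:
  "wt_q (Suc n) T =
    wt_q n T * (\<Prod>i=1..n. qbinomial (nat (NE T i n + SE T i n)) (nat (NE T i n)))"
  unfolding wt_q_def triangle_Suc
  using finite_triangle[of n]
  by (subst prod.union_disjoint) (auto simp: prod.reindex inj_on_def)

lemma area_Suc: "area (Suc n) T = area n T + (\<Sum>i=1..n. NE T i n * SE T i n)"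
  unfolding area_def triangle_Suc
  using finite_triangle[of n]
  by (subst sum.union_disjoint) (auto simp: sum.reindex inj_on_def)

text \<open>The right-hand side does not mention \<open>H\<close>. Generalising over
  \<open>H\<close>, the chains left after any admissible last step \<open>U\<close> have the same
  sum \<open>wt_q n T\<close>, which therefore factors out of the sum over \<open>U\<close>.\<close>

lemma sum_height_chains:
  assumes "finite C" "inj f" "\<forall>c\<in>C. H c \<le> n"
    and "\<forall>i\<in>{1..n}. int (card {c \<in> C. i \<le> H c}) = T (i, n)"
    and "\<forall>i j. 1 \<le> i \<and> i \<le> j \<and> j < n \<longrightarrow> NE T i j \<ge> 0 \<and> SE T i j \<ge> 0"
  shows "(\<Sum>P\<in>height_chains n C H T. qvar ^ chain_inv f C n P) = wt_q n T"
  using assms(3-)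
proof (induction n arbitrary: H)
  case 0
  have "height_chains 0 C H T = {{}}"
    using 0 by (auto simp: height_chains_def gt_index_def height_def)
  then show ?case by (simp add: chain_inv_def wt_q_def)
next
  case (Suc n)
  have IH: "(\<Sum>P\<in>height_chains n C (\<lambda>c. H c - of_bool (c \<in> U)) T. qvar ^ chain_inv f C n P) =
      wt_q n T" if U: "U \<in> steps n C H T" for U
  proof (rule Suc.IH)
    show "\<forall>c\<in>C. H c - of_bool (c \<in> U) \<le> n"
      using U Suc.prems(1) by (force simp: steps_def of_bool_def)
  qed (use U Suc.prems(3) in \<open>auto simp: steps_def\<close>)
  have "(\<Sum>P\<in>height_chains (Suc n) C H T. qvar ^ chain_inv f C (Suc n) P) =
      (\<Sum>U\<in>steps n C H T. wt_q n T * qvar ^ step_inv f C H U)"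
    unfolding sum_height_chains_Suc[OF assms(1) Suc.prems(2)] 
    by (simp add: IH flip: sum_distrib_right)
  also have "\<dots> = wt_q (Suc n) T"
    unfolding wt_q_Suc sum_distrib_left[symmetric]
    by (subst sum_steps) (use assms(1,2) Suc.prems in auto)
  finally show ?case .
qed

text \<open>By injectivity of \<open>f\<close>, each pair of an outside element and a member is
  counted by exactly one of the two opposite orders.\<close>

lemma cross_add_cross:
  assumes "finite A" "V \<subseteq> A" "inj f"
  shows "cross f A V + cross (\<lambda>c. - f c) A V = card V * (card A - card V)"
proof -
  let ?X = "\<lambda>g :: nat \<Rightarrow> int. {(j, x). j \<in> A - V \<and> x \<in> V \<and> g j < g x}"
  have fin: "finite (?X g)" for g
    by (rule finite_subset[of _ "A \<times> A"]) (use assms in auto)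
  have "f j \<noteq> f x" if "j \<in> A - V" "x \<in> V" for j x
    using assms(3) that by (auto dest: injD)
  then have "(A - V) \<times> V = ?X f \<union> ?X (\<lambda>c. - f c)"
    by (auto simp: neq_iff)
  moreover have "card (?X f \<union> ?X (\<lambda>c. - f c)) = card (?X f) + card (?X (\<lambda>c. - f c))"
    by (rule card_Un_disjoint) (use fin[of f] fin[of "\<lambda>c. - f c"] in auto)
  moreover have "card ((A - V) \<times> V) = card V * (card A - card V)"
    using assms by (simp add: card_cartesian_product card_Diff_subset finite_subset mult.commute)
  ultimately show ?thesis by (simp add: cross_def)
qed

text \<open>At each level of each step the two opposite orders together count every pair of a grown
  and an ungrown column. There are \<open>NE\<close> of the former and \<open>SE\<close> of the
  latter, whence the product in \<open>area\<close>.\<close>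

lemma chain_inv_add_chain_inv:
  assumes "finite C" "inj f" "\<forall>c\<in>C. H c \<le> n"
    and "\<forall>i\<in>{1..n}. int (card {c \<in> C. i \<le> H c}) = T (i, n)"
    and "P \<in> height_chains n C H T"
  shows "int (chain_inv f C n P) + int (chain_inv (\<lambda>c. - f c) C n P) = area n T"
  using assms(3-)
proof (induction n arbitrary: H P)
  case 0
  then show ?case by (simp add: chain_inv_def area_def)
next
  case (Suc n)
  define U where "U = {c. (Suc n, c) \<in> P}"
  define P' where "P' = P \<inter> {1..n} \<times> C"
  note S = height_chains_SucD[OF Suc.prems(3), folded U_def P'_def]
  have "int (chain_inv f C n P') + int (chain_inv (\<lambda>c. - f c) C n P') = area n T"
  proof (rule Suc.IH[OF _ _ S(2)])
    show "\<forall>c\<in>C. H c - of_bool (c \<in> U) \<le> n"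
      using S(1) Suc.prems(1) by (force simp: steps_def of_bool_def)
  qed (use S(1) in \<open>auto simp: steps_def\<close>)
  moreover have "int (step_inv f C H U) + int (step_inv (\<lambda>c. - f c) C H U) =
      (\<Sum>i=1..n. NE T i n * SE T i n)"
  proof -
    let ?D = "\<lambda>i. {c \<in> C. H c = i}"
    have lev: "step_inv g C H U = (\<Sum>i=1..n. cross g (?D i) (U \<inter> ?D i))" for g
      by (rule step_inv_levels) (use S(1) assms(1) in \<open>auto simp: steps_def\<close>)
    have "int (cross f (?D i) (U \<inter> ?D i)) + int (cross (\<lambda>c. - f c) (?D i) (U \<inter> ?D i)) =
        NE T i n * SE T i n" if i: "i \<in> {1..n}" for i
    proof -
      have fin: "finite (?D i)" using assms(1) by simp
      have "int (card (U \<inter> ?D i)) = NE T i n"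
        using S(1) i unfolding steps_iff[OF assms(1) Suc.prems(1,2)] by blast
      moreover have "int (card (?D i)) = NE T i n + SE T i n"
        by (rule card_level[OF assms(1) Suc.prems(2) i])
      moreover have "card (U \<inter> ?D i) \<le> card (?D i)"
        using fin by (intro card_mono) auto
      moreover have "cross f (?D i) (U \<inter> ?D i) + cross (\<lambda>c. - f c) (?D i) (U \<inter> ?D i) =
          card (U \<inter> ?D i) * (card (?D i) - card (U \<inter> ?D i))"
        by (rule cross_add_cross) (use fin assms(2) in auto)
      ultimately show ?thesis by (simp add: of_nat_diff flip: of_nat_add)
    qed
    then show ?thesis by (simp add: lev flip: sum.distrib)
  qed
  ultimately show ?case by (simp add: S(3) area_Suc)
qed


section \<open>Column strict fillings\<close>

text \<open>The conjugate partition, meaningful for \<open>c \<ge> 1\<close>; at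
  \<open>c = 0\<close> the set is infinite and \<open>card\<close> returns 0.\<close>

definition col_len :: "(nat \<Rightarrow> nat) \<Rightarrow> nat \<Rightarrow> nat" where
  "col_len lam c = card {r. 1 \<le> r \<and> c \<le> lam r}"

text \<open>The row is forgotten: in a column strict filling it is recovered as the rank of the
  value within its column.\<close>

definition columns :: "(nat \<Rightarrow> nat) \<Rightarrow> filling \<Rightarrow> (nat \<times> nat) set" where
  "columns lam F = {(k, c). \<exists>r. (r, c) \<in> dg lam \<and> F (r, c) = k}"

section \<open>Rows and columns of the diagram\<close>

lemma downward_closed_eq_atLeastAtMost:
  fixes A :: "nat set"
  assumes "finite A" "0 \<notin> A" "\<And>a b. a \<in> A \<Longrightarrow> 1 \<le> b \<Longrightarrow> b \<le> a \<Longrightarrow> b \<in> A"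
  shows "A = {1..card A}"
proof (cases "A = {}")
  case False
  have "a \<noteq> 0" if "a \<in> A" for a using assms(2) that by metis
  then have "A = {1..Max A}"
    using assms(3)[OF Max_in[OF assms(1) False]] Max_ge[OF assms(1)] by (auto simp: Suc_le_eq)
  then show ?thesis by (metis card_atLeastAtMost diff_Suc_1)
qed simp

lemma partition_antimono:
  assumes "is_partition lam" "1 \<le> i" "i \<le> j"
  shows "lam j \<le> lam i"
  using assms(3)
proof (induction j rule: dec_induct)
  case (step m)
  then have "lam (Suc m) \<le> lam m" using assms(1,2) by (simp add: is_partition_def)
  with step show ?case by simp
qed simp

lemma finite_rows:
  assumes "is_partition lam" "1 \<le> c"
  shows "finite {r. 1 \<le> r \<and> c \<le> lam r}"
  by (rule finite_subset[of _ "{i. 1 \<le> i \<and> lam i \<noteq> 0}"])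
    (use assms in \<open>auto simp: is_partition_def\<close>)

lemma dg_iff_col_len:
  assumes "is_partition lam"
  shows "(r, c) \<in> dg lam \<longleftrightarrow> 1 \<le> c \<and> 1 \<le> r \<and> r \<le> col_len lam c"
proof (cases "1 \<le> c")
  case True
  have "{r. 1 \<le> r \<and> c \<le> lam r} = {1..col_len lam c}"
    unfolding col_len_def
  proof (rule downward_closed_eq_atLeastAtMost)
    show "b \<in> {r. 1 \<le> r \<and> c \<le> lam r}"
      if "a \<in> {r. 1 \<le> r \<and> c \<le> lam r}" "1 \<le> b" "b \<le> a" for a b
      using that partition_antimono[OF assms that(2,3)] by auto
  qed (use finite_rows[OF assms True] in auto)
  then show ?thesis using True by (auto simp: dg_def set_eq_iff)
qed (simp add: dg_def)

lemma finite_dg: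
  assumes "is_partition lam"
  shows "finite (dg lam)"
  by (rule finite_subset[of _ "Sigma {i. 1 \<le> i \<and> lam i \<noteq> 0} (\<lambda>i. {1..lam i})"])
    (use assms in \<open>auto simp: dg_def is_partition_def\<close>)

lemma dg_up:
  assumes "is_partition lam" "(r, c) \<in> dg lam" "1 \<le> r'" "r' \<le> r"
  shows "(r', c) \<in> dg lam"
  using assms by (auto simp: dg_iff_col_len)

lemma dg_left: "(r, c) \<in> dg lam \<Longrightarrow> 1 \<le> c' \<Longrightarrow> c' \<le> c \<Longrightarrow> (r, c') \<in> dg lam"
  by (auto simp: dg_def)

lemma dg_pos: "(r, c) \<in> dg lam \<Longrightarrow> 1 \<le> r \<and> 1 \<le> c"
  by (simp add: dg_def)

lemma dg_col:
  assumes "is_partition lam" "(r, c) \<in> dg lam"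
  shows "c \<in> {1..lam 1}"
  using dg_up[OF assms, of 1] dg_pos[OF assms(2)] by (auto simp: dg_def)

lemma CSF_less:
  "F \<in> CSF n lam \<Longrightarrow> (r, c) \<in> dg lam \<Longrightarrow> (r', c) \<in> dg lam \<Longrightarrow> r < r' \<Longrightarrow> F (r, c) < F (r', c)"
  by (auto simp: CSF_def)

lemma CSF_less_iff:
  assumes "F \<in> CSF n lam" "(r, c) \<in> dg lam" "(r', c) \<in> dg lam"
  shows "F (r, c) < F (r', c) \<longleftrightarrow> r < r'"
  using CSF_less[OF assms(1)] assms(2,3) by (metis less_asym' linorder_neqE_nat)

lemma CSF_range: "F \<in> CSF n lam \<Longrightarrow> (r, c) \<in> dg lam \<Longrightarrow> F (r, c) \<in> {1..n}"
  by (auto simp: CSF_def)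

section \<open>Heights of the columns of a filling\<close>

text \<open>Entries increase down a column, so those at most \<open>k\<close> occupy an initial
  segment of it, whose length is the height at time \<open>k\<close>. This equivalence translates
  between cells and heights throughout.\<close>

lemma le_height_columns:
  assumes lam: "is_partition lam" and F: "F \<in> CSF n lam" and r: "1 \<le> r"
  shows "r \<le> height (columns lam F) k c \<longleftrightarrow> (r, c) \<in> dg lam \<and> F (r, c) \<le> k"
proof -
  let ?B = "{r. (r, c) \<in> dg lam \<and> F (r, c) \<le> k}"
  have "{m. m \<le> k \<and> (m, c) \<in> columns lam F} = (\<lambda>r. F (r, c)) ` ?B"
    by (auto simp: columns_def)
  moreover have "inj_on (\<lambda>r. F (r, c)) ?B"
    using CSF_less_iff[OF F] by (intro inj_onI) (metis (mono_tags, lifting) less_irrefl linorder_neqE_nat mem_Collect_eq)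
  ultimately have h: "height (columns lam F) k c = card ?B"
    by (simp add: height_def card_image)
  have "?B = {1..card ?B}"
  proof (rule downward_closed_eq_atLeastAtMost)
    show "finite ?B"
      by (rule finite_subset[of _ "fst ` dg lam"]) (use finite_dg[OF lam] in force)+
    show "0 \<notin> ?B" by (auto dest: dg_pos)
    show "b \<in> ?B" if a: "a \<in> ?B" and b: "1 \<le> b" "b \<le> a" for a b
    proof -
      have "(b, c) \<in> dg lam" using dg_up[OF lam _ b] a by simp
      moreover have "F (b, c) \<le> F (a, c)"
        using CSF_less_iff[OF F, of a c b] a b calculation by (simp add: linorder_not_less[symmetric])
      ultimately show ?thesis using a by simp
    qed
  qed
  then have "r \<in> ?B \<longleftrightarrow> r \<in> {1..card ?B}" by (rule arg_cong[where f = "\<lambda>S. r \<in> S"])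
  then show ?thesis using r unfolding h by simp
qed

lemma height_columns_eq_iff:
  assumes "is_partition lam" "F \<in> CSF n lam" "1 \<le> i"
  shows "height (columns lam F) k c = i \<longleftrightarrow>
    ((i, c) \<in> dg lam \<and> F (i, c) \<le> k) \<and> \<not> ((Suc i, c) \<in> dg lam \<and> F (Suc i, c) \<le> k)"
  using le_height_columns[OF assms, of k c] le_height_columns[OF assms(1,2), of "Suc i" k c] by auto

lemma height_columns_self:
  assumes "is_partition lam" "F \<in> CSF n lam" "(r, c) \<in> dg lam"
  shows "height (columns lam F) (F (r, c)) c = r"
  using assms CSF_less[OF assms(2,3), of "Suc r"] dg_pos[OF assms(3)]
  by (subst height_columns_eq_iff[OF assms(1,2)]) auto

lemma columns_subset:
  assumes "is_partition lam" "F \<in> CSF n lam"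
  shows "columns lam F \<subseteq> {1..n} \<times> {1..lam 1}"
  using CSF_range[OF assms(2)] dg_col[OF assms(1)] by (fastforce simp: columns_def)

section \<open>Fibres of row sorting as height chains\<close>

text \<open>Sorting only permutes a row. This removes \<open>rsort\<close> from the description of
  the fibre.\<close>

lemma card_rsort_le:
  assumes "1 \<le> i"
  shows "card {c. (i, c) \<in> dg lam \<and> rsort lam F (i, c) \<le> k} =
    card {c. (i, c) \<in> dg lam \<and> F (i, c) \<le> k}"
proof -
  have count: "card {c. (i, c) \<in> dg lam \<and> xs ! (c - 1) \<le> k} = length (filter (\<lambda>v. v \<le> k) xs)"
    if "length xs = lam i" for xs :: "nat list"
  proof -
    \<comment> \<open>Columns are counted from 1 and list positions from 0, hence the shift by
      \<open>Suc\<close>.\<close>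
    have "{c. (i, c) \<in> dg lam \<and> xs ! (c - 1) \<le> k} = Suc ` {m. m < length xs \<and> xs ! m \<le> k}"
    proof (intro equalityI subsetI)
      fix c assume "c \<in> {c. (i, c) \<in> dg lam \<and> xs ! (c - 1) \<le> k}"
      then show "c \<in> Suc ` {m. m < length xs \<and> xs ! m \<le> k}"
        using that by (intro image_eqI[of _ _ "c - 1"]) (auto simp: dg_def)
    qed (use that assms in \<open>auto simp: dg_def\<close>)
    then show ?thesis by (simp add: card_image length_filter_conv_card)
  qed
  have len: "length (row_list lam F i) = lam i" by (simp add: row_list_def)
  have "{c. (i, c) \<in> dg lam \<and> rsort lam F (i, c) \<le> k} =
      {c. (i, c) \<in> dg lam \<and> sort (row_list lam F i) ! (c - 1) \<le> k}"
    by (auto simp: rsort_def)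
  moreover have "{c. (i, c) \<in> dg lam \<and> F (i, c) \<le> k} =
      {c. (i, c) \<in> dg lam \<and> row_list lam F i ! (c - 1) \<le> k}"
  proof -
    have "row_list lam F i ! (c - 1) = F (i, c)" if "(i, c) \<in> dg lam" for c
      using that unfolding row_list_def dg_def by (subst nth_map) (auto simp del: upt_Suc)
    then show ?thesis by auto
  qed
  moreover have "length (filter (\<lambda>v. v \<le> k) (sort xs)) = length (filter (\<lambda>v. v \<le> k) xs)"
    for xs :: "nat list"
    by (metis filter_sort length_sort)
  ultimately show ?thesis by (simp only: count len length_sort)
qed

lemma rsort_fibre_iff:
  assumes "T \<in> extensional (gt_index n)"
  shows "F \<in> rsort_fibre n lam T \<longleftrightarrow> F \<in> CSF n lam \<and>
    (\<forall>(i, k)\<in>gt_index n. int (card {c. (i, c) \<in> dg lam \<and> F (i, c) \<le> k}) = T (i, k))"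
proof -
  have "tableau_to_gt n lam (rsort lam F) = T \<longleftrightarrow>
      (\<forall>(i, k)\<in>gt_index n. int (card {c. (i, c) \<in> dg lam \<and> rsort lam F (i, c) \<le> k}) = T (i, k))"
    using assms unfolding tableau_to_gt_def extensional_def fun_eq_iff restrict_def by auto
  also have "\<dots> \<longleftrightarrow> (\<forall>(i, k)\<in>gt_index n. int (card {c. (i, c) \<in> dg lam \<and> F (i, c) \<le> k}) = T (i, k))"
    by (rule ball_cong) (auto simp: gt_index_def card_rsort_le)
  finally show ?thesis by (simp add: rsort_fibre_def)
qed

text \<open>The heights determine which \<open>k\<close> bound the entry of a given cell, hence the
  entry itself.\<close>

lemma inj_on_columns:
  assumes "is_partition lam"
  shows "inj_on (columns lam) (CSF n lam)"
proof (rule inj_onI)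
  fix F G assume F: "F \<in> CSF n lam" and G: "G \<in> CSF n lam" and eq: "columns lam F = columns lam G"
  show "F = G"
  proof (rule extensionalityI[of _ "dg lam"])
    fix x assume "x \<in> dg lam"
    then obtain r c where x: "x = (r, c)" "(r, c) \<in> dg lam" by (cases x) auto
    then have "F (r, c) \<le> k \<longleftrightarrow> G (r, c) \<le> k" for k
      using le_height_columns[OF assms F, of r k c] le_height_columns[OF assms G, of r k c]
        dg_pos[of r c lam] eq by simp
    then show "F x = G x" unfolding x by (meson order_antisym order_refl)
  qed (use F G in \<open>auto simp: CSF_def PiE_def\<close>)
qed

text \<open>The filling is rebuilt by placing in row \<open>r\<close> of column \<open>c\<close> the
  time at which that column reaches height \<open>r\<close>.\<close>

lemma columns_surj:
  assumes lam: "is_partition lam"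
    and P: "P \<subseteq> {1..n} \<times> {1..lam 1}" "\<forall>c\<in>{1..lam 1}. height P n c = col_len lam c"
  obtains F where "F \<in> CSF n lam" "columns lam F = P"
proof -
  define F where "F = (\<lambda>(r, c)\<in>dg lam. LEAST k. r \<le> height P k c)"
  have z: "(0, c) \<notin> P" for c using P(1) by auto
  \<comment> \<open>The time \<open>n\<close> shows that the \<open>LEAST\<close> is attained, and
    monotonicity of the height gives both directions.\<close>
  have F_le: "F (r, c) \<le> k \<longleftrightarrow> r \<le> height P k c" if rc: "(r, c) \<in> dg lam" for r c k
  proof -
    have "r \<le> height P n c"
      using rc P(2) dg_col[OF lam rc] dg_iff_col_len[OF lam, of r c] by simp
    then have "r \<le> height P (LEAST k. r \<le> height P k c) c" by (rule LeastI)
    then show ?thesis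
      using rc height_mono[of "LEAST k. r \<le> height P k c" k P c]
      by (auto simp: F_def intro: Least_le)
  qed
  have CSF: "F \<in> CSF n lam"
    unfolding CSF_def
  proof (intro CollectI conjI allI impI PiE_I)
    fix x assume "x \<in> dg lam"
    then obtain r c where x: "x = (r, c)" "(r, c) \<in> dg lam" by (cases x) auto
    have "\<not> F (r, c) \<le> 0" using F_le[OF x(2), of 0] dg_pos[OF x(2)] by (simp add: height_0 z)
    moreover have "F (r, c) \<le> n"
      using F_le[OF x(2)] P(2) dg_col[OF lam x(2)] x(2) dg_iff_col_len[OF lam, of r c] by simp
    ultimately show "F x \<in> {1..n}" by (simp add: x)
  next
    fix r r' c assume a: "(r, c) \<in> dg lam \<and> (r', c) \<in> dg lam \<and> r < r'"
    \<comment> \<open>\<open>k\<close> is the last time before column \<open>c\<close> reaches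
      height \<open>r'\<close>. A height grows by at most one per step, so at time \<open>k\<close>
      it is already at least \<open>r' - 1\<close>, hence at least \<open>r\<close>.\<close>
    define k where "k = F (r', c) - 1"
    have "\<not> F (r', c) \<le> 0" using F_le[of r' c 0] a dg_pos[of r' c] by (simp add: height_0 z)
    then have k: "F (r', c) = Suc k" by (simp add: k_def)
    have "r' \<le> height P (Suc k) c" using F_le[of r' c "Suc k"] a k by simp
    then have "r \<le> height P k c" using a by (simp add: height_Suc of_bool_def split: if_splits)
    then show "F (r, c) < F (r', c)" using F_le[of r c k] a k by simp
  qed (simp add: F_def)
  have "(m, c) \<in> columns lam F \<longleftrightarrow> (m, c) \<in> P" for m c
  proof
    assume "(m, c) \<in> columns lam F"
    then obtain r where r: "(r, c) \<in> dg lam" "F (r, c) = m" by (auto simp: columns_def)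
    have "F (r, c) \<in> {1..n}" using CSF_range[OF CSF r(1)] .
    then obtain k where m: "m = Suc k" using r(2) by (cases m) auto
    have "r \<le> height P (Suc k) c" "\<not> r \<le> height P k c"
      using F_le[OF r(1), of "Suc k"] F_le[OF r(1), of k] r(2) m by auto
    then show "(m, c) \<in> P" by (auto simp: height_Suc m of_bool_def split: if_splits)
  next
    assume mc: "(m, c) \<in> P"
    then obtain k where m: "m = Suc k" and c: "c \<in> {1..lam 1}" and "m \<le> n"
      using P(1) by (cases m) auto
    \<comment> \<open>The row that the value \<open>m\<close> must occupy: column \<open>c\<close>
      reaches height \<open>r\<close> exactly at time \<open>m\<close>.\<close>
    define r where "r = height P m c"
    have r: "r = Suc (height P k c)" using mc by (simp add: r_def m height_Suc)
    have "r \<le> col_len lam c"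
      using height_mono[OF \<open>m \<le> n\<close>, of P c] P(2) c by (simp add: r_def)
    then have dg: "(r, c) \<in> dg lam"
      using c r by (simp add: dg_iff_col_len[OF lam])
    have "F (r, c) \<le> Suc k" "\<not> F (r, c) \<le> k"
      unfolding F_le[OF dg] using r r_def m by auto
    then show "(m, c) \<in> columns lam F"
      using dg unfolding columns_def m by (auto intro!: exI[of _ r])
  qed
  then have "columns lam F = P" by auto
  with CSF show ?thesis using that by blast
qed

text \<open>Under \<open>le_height_columns\<close> the row counts defining the fibre become counts
  of columns of height at least \<open>i\<close>. All entries are at most \<open>n\<close>, so the
  heights at time \<open>n\<close> are the full column lengths.\<close>

lemma bij_betw_columns:
  assumes lam: "is_partition lam" and T: "T \<in> extensional (gt_index n)"
  shows "bij_betw (columns lam) (rsort_fibre n lam T)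
    (height_chains n {1..lam 1} (col_len lam) T)"
proof -
  have "rsort_fibre n lam T \<subseteq> CSF n lam" by (auto simp: rsort_fibre_def)
  then have inj: "inj_on (columns lam) (rsort_fibre n lam T)"
    by (rule inj_on_subset[OF inj_on_columns[OF lam]])
  have cnt: "{c \<in> {1..lam 1}. i \<le> height (columns lam F) k c} =
      {c. (i, c) \<in> dg lam \<and> F (i, c) \<le> k}" if "F \<in> CSF n lam" "1 \<le> i" for F i k
    unfolding le_height_columns[OF lam that] using dg_col[OF lam] by auto
  have iff: "F \<in> rsort_fibre n lam T \<longleftrightarrow> columns lam F \<in> height_chains n {1..lam 1} (col_len lam) T"
    if F: "F \<in> CSF n lam" for F
  proof -
    have "height (columns lam F) n c = col_len lam c" if c: "c \<in> {1..lam 1}" for c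
    proof -
      have "r \<le> height (columns lam F) n c \<longleftrightarrow> r \<le> col_len lam c" if "1 \<le> r" for r
        using le_height_columns[OF lam F that, of n c] CSF_range[OF F, of r c]
          dg_iff_col_len[OF lam, of r c] c that by auto
      \<comment> \<open>Two natural numbers with the same positive lower bounds are equal.\<close>
      then show ?thesis by (metis Suc_leI le_antisym le_refl less_one not_less zero_le)
    qed
    moreover have "(\<forall>(i, k)\<in>gt_index n. int (card {c. (i, c) \<in> dg lam \<and> F (i, c) \<le> k}) = T (i, k)) \<longleftrightarrow>
      (\<forall>(i, k)\<in>gt_index n. int (card {c \<in> {1..lam 1}. i \<le> height (columns lam F) k c}) = T (i, k))"
      by (rule ball_cong) (use cnt[OF F] in \<open>auto simp: gt_index_def\<close>)
    ultimately show ?thesis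
      using columns_subset[OF lam F] F by (simp add: rsort_fibre_iff[OF T] height_chains_def)
  qed
  have "columns lam ` rsort_fibre n lam T = height_chains n {1..lam 1} (col_len lam) T"
  proof (intro equalityI subsetI)
    fix P assume P: "P \<in> height_chains n {1..lam 1} (col_len lam) T"
    then obtain F where "F \<in> CSF n lam" "columns lam F = P"
      using columns_surj[OF lam, of P n] by (auto simp: height_chains_def)
    with P iff show "P \<in> columns lam ` rsort_fibre n lam T" by auto
  next
    fix P assume "P \<in> columns lam ` rsort_fibre n lam T"
    then show "P \<in> height_chains n {1..lam 1} (col_len lam) T"
      using iff by (auto simp: rsort_fibre_def)
  qed
  with inj show ?thesis by (simp add: bij_betw_def)
qed


section \<open>The two statistics\<close>

text \<open>A common index set for attacking pairs and arms: two cells of one row, to which the cell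
  below (\<open>quinv\<close>) or above (\<open>inv\<close>) the left one is added when it
  exists.\<close>

definition row_triples :: "(nat \<Rightarrow> nat) \<Rightarrow> (nat \<times> nat \<times> nat) set" where
  "row_triples lam = {(i, j, x). (i, j) \<in> dg lam \<and> (i, x) \<in> dg lam \<and> j < x}"

lemma finite_row_triples:
  assumes "is_partition lam"
  shows "finite (row_triples lam)"
proof (rule finite_surj)
  show "finite (dg lam \<times> dg lam)" using finite_dg[OF assms] by simp
  show "row_triples lam \<subseteq> (\<lambda>((i, j), (i', x)). (i, j, x)) ` (dg lam \<times> dg lam)"
    by (force simp: row_triples_def)
qed

text \<open>If every failure of \<open>A\<close> is compensated by an element of \<open>R\<close>,
  the correction by the arms cancels these elements.\<close>

lemma card_cancel:
  assumes "finite B" "\<And>t. t \<in> B \<Longrightarrow> E t \<Longrightarrow> \<not> A t \<Longrightarrow> R t"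
  shows "int (card {t \<in> B. R t}) + int (card {t \<in> B. E t \<and> A t}) - int (card {t \<in> B. E t}) =
    int (card {t \<in> B. R t \<and> \<not> (E t \<and> \<not> A t)})"
proof -
  have "{t \<in> B. R t} = {t \<in> B. R t \<and> \<not> (E t \<and> \<not> A t)} \<union> {t \<in> B. E t \<and> \<not> A t}"
    using assms(2) by auto
  then have "card {t \<in> B. R t} = card {t \<in> B. R t \<and> \<not> (E t \<and> \<not> A t)} + card {t \<in> B. E t \<and> \<not> A t}"
    using assms(1) by (subst card_Un_disjoint[symmetric]) auto
  moreover have "{t \<in> B. E t} = {t \<in> B. E t \<and> A t} \<union> {t \<in> B. E t \<and> \<not> A t}"
    by auto
  then have "card {t \<in> B. E t} = card {t \<in> B. E t \<and> A t} + card {t \<in> B. E t \<and> \<not> A t}"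
    using assms(1) by (subst card_Un_disjoint[symmetric]) auto
  ultimately show ?thesis by simp
qed

section \<open>Cancelling the arms against attacking pairs\<close>

lemma Des_CSF:
  assumes "is_partition lam" "F \<in> CSF n lam"
  shows "Des lam F = {u \<in> dg lam. fst u > 1}"
proof -
  have "F (i, j) > F (i - 1, j)" if "(i, j) \<in> dg lam" "i > 1" for i j
    using CSF_less[OF assms(2), of "i - 1" j i] dg_up[OF assms(1) that(1), of "i - 1"] that by simp
  then show ?thesis by (auto simp: Des_def)
qed

text \<open>\<open>?R\<close> marks inversions within a row, \<open>?E\<close> the existence of the
  cell below the left one, and \<open>?A\<close> an inversion between that cell and the right one.
  Column strictness makes a failure of \<open>?A\<close> force \<open>?R\<close>, so
  \<open>card_cancel\<close> absorbs the arms.\<close>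

lemma quinv_stat_eq_card_triples:
  assumes lam: "is_partition lam" and F: "F \<in> CSF n lam"
  shows "quinv_stat lam F = int (card {(i, j, x) \<in> row_triples lam. F (i, j) < F (i, x) \<and>
    \<not> ((Suc i, j) \<in> dg lam \<and> F (Suc i, j) \<le> F (i, x))})"
proof -
  let ?B = "row_triples lam"
  let ?R = "\<lambda>(i, j, x). F (i, j) < F (i, x)"
  let ?E = "\<lambda>(i, j, x :: nat). (Suc i, j) \<in> dg lam"
  let ?A = "\<lambda>(i, j, x). F (Suc i, j) > F (i, x)"
  define f where "f = (\<lambda>(i, j, x). ((i, x), (i, j)) :: cell \<times> cell)"
  define g where "g = (\<lambda>(i, j, x). ((Suc i, j), (i, x)) :: cell \<times> cell)"
  have inj: "inj_on f S" "inj_on g S" for S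
    by (auto simp: f_def g_def inj_on_def)
  have fin: "finite ?B" using finite_row_triples[OF lam] .
  have "Quinv_pairs lam F = f ` {t \<in> ?B. ?R t} \<union> g ` {t \<in> ?B. ?E t \<and> ?A t}" (is "_ = ?U")
  proof (intro equalityI subsetI)
    fix p assume p: "p \<in> Quinv_pairs lam F"
    obtain i j i' j' where p_eq: "p = ((i, j), (i', j'))" by (metis surj_pair)
    have d: "(i, j) \<in> dg lam" "(i', j') \<in> dg lam" "F (i, j) > F (i', j')"
      and "(i = i' \<and> j > j') \<or> (i = i' + 1 \<and> j < j')"
      using p by (auto simp: Quinv_pairs_def p_eq)
    then consider "i = i'" "j > j'" | "i = Suc i'" "j < j'" by auto
    then show "p \<in> ?U"
    proof cases
      case 1
      then have "p = f (i, j', j)" "(i, j', j) \<in> ?B" "?R (i, j', j)"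
        using d by (auto simp: f_def p_eq row_triples_def)
      then show ?thesis by blast
    next
      case 2
      have "(i', j) \<in> dg lam" using dg_left[OF d(2)] dg_pos[OF d(1)] 2 by simp
      then have "p = g (i', j, j')" "(i', j, j') \<in> ?B" "?E (i', j, j')" "?A (i', j, j')"
        using d 2 by (auto simp: g_def p_eq row_triples_def)
      then show ?thesis by blast
    qed
  qed (auto simp: f_def g_def row_triples_def Quinv_pairs_def)
  moreover have "f ` {t \<in> ?B. ?R t} \<inter> g ` {t \<in> ?B. ?E t \<and> ?A t} = {}"
    by (auto simp: f_def g_def)
  ultimately have pairs: "card (Quinv_pairs lam F) = card {t \<in> ?B. ?R t} + card {t \<in> ?B. ?E t \<and> ?A t}"
    using fin by (simp add: card_Un_disjoint card_image inj)
  have "(\<Sum>u\<in>Des lam F. arm lam (up u)) =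
      card (Sigma {u \<in> dg lam. fst u > 1} (\<lambda>u. {v \<in> dg lam. fst v = fst (up u) \<and> snd v > snd (up u)}))"
    unfolding Des_CSF[OF lam F] arm_def using finite_dg[OF lam] by (subst card_SigmaI) auto
  also have "Sigma {u \<in> dg lam. fst u > 1} (\<lambda>u. {v \<in> dg lam. fst v = fst (up u) \<and> snd v > snd (up u)}) =
      g ` {t \<in> ?B. ?E t}"
  proof (intro equalityI subsetI)
    fix p assume p: "p \<in> Sigma {u \<in> dg lam. fst u > 1}
      (\<lambda>u. {v \<in> dg lam. fst v = fst (up u) \<and> snd v > snd (up u)})"
    obtain i j i' j' where p_eq: "p = ((i, j), (i', j'))" by (metis surj_pair)
    have d: "(i, j) \<in> dg lam" "(i', j') \<in> dg lam" "i = Suc i'" "j < j'"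
      using p by (auto simp: p_eq)
    have "(i', j) \<in> dg lam" using dg_left[OF d(2)] dg_pos[OF d(1)] d by simp
    then have "p = g (i', j, j')" "(i', j, j') \<in> ?B" "?E (i', j, j')"
      using d by (auto simp: g_def p_eq row_triples_def)
    then show "p \<in> g ` {t \<in> ?B. ?E t}" by blast
  qed (auto simp: g_def row_triples_def dest: dg_pos)
  finally have arms: "(\<Sum>u\<in>Des lam F. arm lam (up u)) = card {t \<in> ?B. ?E t}"
    by (simp add: card_image inj)
  have "?R t" if t: "t \<in> ?B" "?E t" "\<not> ?A t" for t
  proof -
    obtain i j x where t_eq: "t = (i, j, x)" by (metis surj_pair)
    have "F (i, j) < F (Suc i, j)"
      by (rule CSF_less[OF F]) (use t in \<open>auto simp: t_eq row_triples_def\<close>)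
    then show ?thesis using t by (simp add: t_eq)
  qed
  from card_cancel[OF fin this]
  have "quinv_stat lam F = int (card {t \<in> ?B. ?R t \<and> \<not> (?E t \<and> \<not> ?A t)})"
    unfolding quinv_stat_def pairs of_nat_sum[symmetric] arms by simp
  also have "{t \<in> ?B. ?R t \<and> \<not> (?E t \<and> \<not> ?A t)} = {(i, j, x) \<in> row_triples lam. F (i, j) < F (i, x) \<and>
    \<not> ((Suc i, j) \<in> dg lam \<and> F (Suc i, j) \<le> F (i, x))}"
    by auto
  finally show ?thesis .
qed

text \<open>The same cancellation, now with the cell above the left one: if the right entry does not
  exceed that cell, then it is smaller than the left entry by column strictness.\<close>

lemma inv_stat_eq_card_triples:
  assumes lam: "is_partition lam" and F: "F \<in> CSF n lam"
  shows "inv_stat lam F = int (card {(i, j, x) \<in> row_triples lam. F (i, x) < F (i, j) \<and>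
    \<not> (i > 1 \<and> F (i, x) \<le> F (i - 1, j))})"
proof -
  let ?B = "row_triples lam"
  let ?R = "\<lambda>(i, j, x). F (i, j) > F (i, x)"
  let ?E = "\<lambda>(i, j :: nat, x :: nat). i > (1 :: nat)"
  let ?A = "\<lambda>(i, j, x). F (i, x) > F (i - 1, j)"
  define f where "f = (\<lambda>(i, j, x). ((i, j), (i, x)) :: cell \<times> cell)"
  define g where "g = (\<lambda>(i, j, x). ((i, x), (i - 1, j)) :: cell \<times> cell)"
  have inj: "inj_on f S" "inj_on g {t \<in> S. ?E t \<and> ?A t}" for S
    by (auto simp: f_def g_def inj_on_def)
  have fin: "finite ?B" using finite_row_triples[OF lam] .
  have "Inv_pairs lam F = f ` {t \<in> ?B. ?R t} \<union> g ` {t \<in> ?B. ?E t \<and> ?A t}" (is "_ = ?U")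
  proof (intro equalityI subsetI)
    fix p assume p: "p \<in> Inv_pairs lam F"
    obtain i j i' j' where p_eq: "p = ((i, j), (i', j'))" by (metis surj_pair)
    have d: "(i, j) \<in> dg lam" "(i', j') \<in> dg lam" "F (i, j) > F (i', j')"
      and "(i = i' \<and> j < j') \<or> (i = i' + 1 \<and> j > j')"
      using p by (auto simp: Inv_pairs_def p_eq)
    then consider "i = i'" "j < j'" | "i = Suc i'" "j > j'" by auto
    then show "p \<in> ?U"
    proof cases
      case 1
      then have "p = f (i, j, j')" "(i, j, j') \<in> ?B" "?R (i, j, j')"
        using d by (auto simp: f_def p_eq row_triples_def)
      then show ?thesis by blast
    next
      case 2
      have "(i, j') \<in> dg lam" using dg_left[OF d(1)] dg_pos[OF d(2)] 2 by simp
      then have "p = g (i, j', j)" "(i, j', j) \<in> ?B" "?E (i, j', j)" "?A (i, j', j)"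
        using d 2 dg_pos[OF d(2)] by (auto simp: g_def p_eq row_triples_def)
      then show ?thesis by blast
    qed
  next
    fix p assume "p \<in> ?U"
    then consider i j x where "p = ((i, j), (i, x))" "(i, j, x) \<in> ?B" "?R (i, j, x)"
      | i j x where "p = ((i, x), (i - 1, j))" "(i, j, x) \<in> ?B" "?E (i, j, x)" "?A (i, j, x)"
      by (auto simp: f_def g_def)
    then show "p \<in> Inv_pairs lam F"
    proof cases
      case 1
      then show ?thesis by (auto simp: row_triples_def Inv_pairs_def)
    next
      case 2
      have "(i - 1, j) \<in> dg lam"
        by (rule dg_up[OF lam, of i]) (use 2 in \<open>auto simp: row_triples_def\<close>)
      then show ?thesis using 2 by (auto simp: row_triples_def Inv_pairs_def)
    qed
  qed
  moreover have "f ` {t \<in> ?B. ?R t} \<inter> g ` {t \<in> ?B. ?E t \<and> ?A t} = {}"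
    by (auto simp: f_def g_def row_triples_def)
  ultimately have pairs: "card (Inv_pairs lam F) = card {t \<in> ?B. ?R t} + card {t \<in> ?B. ?E t \<and> ?A t}"
    using fin card_image[OF inj(2)[of ?B]] by (simp add: card_Un_disjoint card_image inj(1))
  have "(\<Sum>u\<in>Des lam F. arm lam u) =
      card (Sigma {u \<in> dg lam. fst u > 1} (\<lambda>u. {v \<in> dg lam. fst v = fst u \<and> snd v > snd u}))"
    unfolding Des_CSF[OF lam F] arm_def using finite_dg[OF lam] by (subst card_SigmaI) auto
  \<comment> \<open>The arm of \<open>u\<close> lies in the row of \<open>u\<close>, so its pairs
    are coded by \<open>f\<close>. For \<open>quinv\<close> the arm of \<open>up u\<close> lies one
    row higher and is coded by \<open>g\<close>.\<close>
  also have "Sigma {u \<in> dg lam. fst u > 1} (\<lambda>u. {v \<in> dg lam. fst v = fst u \<and> snd v > snd u}) =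
      f ` {t \<in> ?B. ?E t}"
    by (force simp: f_def row_triples_def)
  finally have arms: "(\<Sum>u\<in>Des lam F. arm lam u) = card {t \<in> ?B. ?E t}"
    by (simp add: card_image inj)
  have "?R t" if t: "t \<in> ?B" "?E t" "\<not> ?A t" for t
  proof -
    obtain i j x where t_eq: "t = (i, j, x)" by (metis surj_pair)
    have "F (i - 1, j) < F (i, j)"
      by (rule CSF_less[OF F])
        (use t in \<open>auto simp: t_eq row_triples_def intro: dg_up[OF lam, of i]\<close>)
    then show ?thesis using t by (simp add: t_eq)
  qed
  from card_cancel[OF fin this]
  have "inv_stat lam F = int (card {t \<in> ?B. ?R t \<and> \<not> (?E t \<and> \<not> ?A t)})"
    unfolding inv_stat_def pairs of_nat_sum[symmetric] arms by simp
  also have "{t \<in> ?B. ?R t \<and> \<not> (?E t \<and> \<not> ?A t)} = {(i, j, x) \<in> row_triples lam. F (i, x) < F (i, j) \<and>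
    \<not> (i > 1 \<and> F (i, x) \<le> F (i - 1, j))}"
    by auto
  finally show ?thesis .
qed

section \<open>From row triples to growth steps\<close>

lemma chain_inv_eq_card:
  assumes "finite C"
  shows "chain_inv f C n P = card {(k, j, x). k \<in> {1..n} \<and> j \<in> C \<and> x \<in> C \<and> f j < f x \<and>
    (k, j) \<notin> P \<and> (k, x) \<in> P \<and> height P k j = height P k x}"
proof -
  let ?S = "\<lambda>k. {(j, x). j \<in> C - {c. (k, c) \<in> P} \<and> x \<in> C \<inter> {c. (k, c) \<in> P} \<and>
    height P k j = height P k x \<and> f j < f x}"
  have "finite (?S k)" for k
    by (rule finite_subset[of _ "C \<times> C"]) (use assms in auto)
  then have "chain_inv f C n P = card (Sigma {1..n} ?S)"
    by (simp add: chain_inv_def step_inv_def)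
  also have "Sigma {1..n} ?S = {(k, j, x). k \<in> {1..n} \<and> j \<in> C \<and> x \<in> C \<and> f j < f x \<and>
    (k, j) \<notin> P \<and> (k, x) \<in> P \<and> height P k j = height P k x}"
    by auto
  finally show ?thesis .
qed

text \<open>Read a triple \<open>(i, j, x)\<close> at time \<open>k = F (i, x)\<close>, when column
  \<open>x\<close> reaches height \<open>i\<close>. The inequalities say that column
  \<open>j\<close> then has height \<open>i\<close> too, but reached it earlier.\<close>

lemma quinv_stat_eq_chain_inv:
  assumes lam: "is_partition lam" and F: "F \<in> CSF n lam"
  shows "quinv_stat lam F = int (chain_inv int {1..lam 1} n (columns lam F))"
proof -
  let ?P = "columns lam F"
  let ?S = "{(i, j, x) \<in> row_triples lam. F (i, j) < F (i, x) \<and>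
    \<not> ((Suc i, j) \<in> dg lam \<and> F (Suc i, j) \<le> F (i, x))}"
  let ?S' = "{(k, j, x). k \<in> {1..n} \<and> j \<in> {1..lam 1} \<and> x \<in> {1..lam 1} \<and> int j < int x \<and>
    (k, j) \<notin> ?P \<and> (k, x) \<in> ?P \<and> height ?P k j = height ?P k x}"
  define h where "h = (\<lambda>(i, j, x :: nat). (F (i, x), j :: nat, x))"
  have "inj_on h ?S"
  proof (rule inj_onI)
    fix s t assume st: "s \<in> ?S" "t \<in> ?S" "h s = h t"
    obtain i j x i' j' x' where eq: "s = (i, j, x)" "t = (i', j', x')" by (metis surj_pair)
    show "s = t"
      \<comment> \<open>Strictness down column \<open>x\<close> recovers the row \<open>i\<close>
        from the value \<open>F (i, x)\<close>.\<close>
      using st CSF_less_iff[OF F, of i x i'] CSF_less_iff[OF F, of i' x i]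
      by (auto simp: h_def eq row_triples_def)
  qed
  moreover have "h ` ?S = ?S'"
  proof (intro equalityI subsetI)
    fix y assume "y \<in> h ` ?S"
    then obtain i j x where y: "y = (F (i, x), j, x)" and d: "(i, j) \<in> dg lam" "(i, x) \<in> dg lam" "j < x"
      and lt: "F (i, j) < F (i, x)" and nle: "\<not> ((Suc i, j) \<in> dg lam \<and> F (Suc i, j) \<le> F (i, x))"
      by (auto simp: h_def row_triples_def)
    have i: "1 \<le> i" using dg_pos[OF d(1)] by simp
    have hj: "height ?P (F (i, x)) j = i"
      using d lt nle by (simp add: height_columns_eq_iff[OF lam F i])
    have "(F (i, x), j) \<notin> ?P"
    proof
      assume "(F (i, x), j) \<in> ?P"
      then obtain r where r: "(r, j) \<in> dg lam" "F (r, j) = F (i, x)" by (auto simp: columns_def)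
      with hj height_columns_self[OF lam F r(1)] have "r = i" by simp
      with r lt show False by simp
    qed
    moreover have "(F (i, x), x) \<in> ?P" using d by (auto simp: columns_def)
    ultimately show "y \<in> ?S'"
      using hj height_columns_self[OF lam F d(2)] CSF_range[OF F d(2)]
        dg_col[OF lam d(1)] dg_col[OF lam d(2)] d(3) by (simp add: y)
  next
    fix y assume "y \<in> ?S'"
    then obtain k j x where y: "y = (k, j, x)" and k: "(k, j) \<notin> ?P" "(k, x) \<in> ?P"
      and h: "height ?P k j = height ?P k x" and jx: "j < x"
      by auto
    obtain i where i: "(i, x) \<in> dg lam" "F (i, x) = k" using k(2) by (auto simp: columns_def)
    have i1: "1 \<le> i" using dg_pos[OF i(1)] by simp
    have "height ?P k j = i" using h height_columns_self[OF lam F i(1)] i(2) by simp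
    then have "(i, j) \<in> dg lam" "F (i, j) \<le> k" "\<not> ((Suc i, j) \<in> dg lam \<and> F (Suc i, j) \<le> k)"
      unfolding height_columns_eq_iff[OF lam F i1] by auto
    moreover from this(1) have "F (i, j) \<noteq> k" using k(1) by (auto simp: columns_def)
    ultimately have "(i, j, x) \<in> ?S" using i jx by (auto simp: row_triples_def)
    then show "y \<in> h ` ?S" using y i by (force simp: h_def)
  qed
  ultimately have "bij_betw h ?S ?S'" by (simp only: bij_betw_def)
  then have "card ?S = card ?S'" by (rule bij_betw_same_card)
  then show ?thesis
    unfolding quinv_stat_eq_card_triples[OF lam F] chain_inv_eq_card[OF finite_atLeastAtMost] by simp
qed

text \<open>At time \<open>k = F (i, x)\<close> the inequalities say that column \<open>j\<close>
  stays at height \<open>i - 1\<close> while column \<open>x\<close> grows from \<open>i - 1\<close>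
  to \<open>i\<close>. The pair is thus level before the step.\<close>

lemma inv_stat_eq_card_steps:
  assumes lam: "is_partition lam" and F: "F \<in> CSF n lam"
  defines "P \<equiv> columns lam F"
  shows "inv_stat lam F = int (card {(k, j, x). k \<in> {1..n} \<and> j \<in> {1..lam 1} \<and> x \<in> {1..lam 1} \<and>
    j < x \<and> (k, j) \<notin> P \<and> (k, x) \<in> P \<and> Suc (height P k j) = height P k x})"
proof -
  let ?S = "{(i, j, x) \<in> row_triples lam. F (i, x) < F (i, j) \<and>
    \<not> (i > 1 \<and> F (i, x) \<le> F (i - 1, j))}"
  let ?S' = "{(k, j, x). k \<in> {1..n} \<and> j \<in> {1..lam 1} \<and> x \<in> {1..lam 1} \<and>
    j < x \<and> (k, j) \<notin> P \<and> (k, x) \<in> P \<and> Suc (height P k j) = height P k x}"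
  define h where "h = (\<lambda>(i, j, x :: nat). (F (i, x), j :: nat, x))"
  have le: "r \<le> height P k c \<longleftrightarrow> (r, c) \<in> dg lam \<and> F (r, c) \<le> k" if "1 \<le> r" for r k c
    unfolding P_def by (rule le_height_columns[OF lam F that])
  have self: "height P (F (r, c)) c = r" if "(r, c) \<in> dg lam" for r c
    unfolding P_def by (rule height_columns_self[OF lam F that])
  have "inj_on h ?S"
  proof (rule inj_onI)
    fix s t assume st: "s \<in> ?S" "t \<in> ?S" "h s = h t"
    obtain i j x i' j' x' where eq: "s = (i, j, x)" "t = (i', j', x')" by (metis surj_pair)
    show "s = t"
      using st CSF_less_iff[OF F, of i x i'] CSF_less_iff[OF F, of i' x i]
      by (auto simp: h_def eq row_triples_def)
  qed
  moreover have "h ` ?S = ?S'"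
  proof (intro equalityI subsetI)
    fix y assume "y \<in> h ` ?S"
    then obtain i j x where y: "y = (F (i, x), j, x)" and d: "(i, j) \<in> dg lam" "(i, x) \<in> dg lam" "j < x"
      and lt: "F (i, x) < F (i, j)" and nle: "\<not> (i > 1 \<and> F (i, x) \<le> F (i - 1, j))"
      by (auto simp: h_def row_triples_def)
    have i: "1 \<le> i" using dg_pos[OF d(1)] by simp
    have up: "(i - 1, j) \<in> dg lam" if "i > 1"
      by (rule dg_up[OF lam d(1)]) (use that in auto)
    have "\<not> i \<le> height P (F (i, x)) j" using le[OF i] lt by simp
    \<comment> \<open>For \<open>i = 1\<close> the bound is trivial; otherwise the cell above
      \<open>(i, j)\<close> has been filled by time \<open>F (i, x)\<close>.\<close>
    moreover have "i - 1 \<le> height P (F (i, x)) j"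
      using le[of "i - 1" "F (i, x)" j] up nle by (cases "i > 1") auto
    ultimately have hj: "Suc (height P (F (i, x)) j) = i" by simp
    have "(F (i, x), j) \<notin> P"
    proof
      assume "(F (i, x), j) \<in> P"
      then obtain r where r: "(r, j) \<in> dg lam" "F (r, j) = F (i, x)" by (auto simp: columns_def P_def)
      have "Suc r = i" using self[OF r(1)] hj r(2) by simp
      then show False using nle r dg_pos[OF r(1)] by auto
    qed
    moreover have "(F (i, x), x) \<in> P" using d by (auto simp: columns_def P_def)
    ultimately show "y \<in> ?S'"
      using hj self[OF d(2)] CSF_range[OF F d(2)]
        dg_col[OF lam d(1)] dg_col[OF lam d(2)] d(3) by (simp add: y)
  next
    fix y assume "y \<in> ?S'"
    then obtain k j x where y: "y = (k, j, x)" and k: "(k, j) \<notin> P" "(k, x) \<in> P"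
      and h: "Suc (height P k j) = height P k x" and jx: "j < x" "1 \<le> j"
      by auto
    obtain i where i: "(i, x) \<in> dg lam" "F (i, x) = k" using k(2) by (auto simp: columns_def P_def)
    have i1: "1 \<le> i" using dg_pos[OF i(1)] by simp
    have hj: "Suc (height P k j) = i" using h self[OF i(1)] i(2) by simp
    have ij: "(i, j) \<in> dg lam" using dg_left[OF i(1)] jx by simp
    have "F (i, x) < F (i, j)" using le[OF i1, of k j] ij hj i(2) by simp
    moreover have "F (i - 1, j) < F (i, x)" if "i > 1"
    proof -
      have "(i - 1, j) \<in> dg lam" "F (i - 1, j) \<le> k" using le[of "i - 1" k j] that hj by auto
      moreover from this(1) have "F (i - 1, j) \<noteq> k" using k(1) by (auto simp: columns_def P_def)
      ultimately show ?thesis using i(2) by simp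
    qed
    ultimately have "(i, j, x) \<in> ?S" using i ij jx by (auto simp: row_triples_def)
    then show "y \<in> h ` ?S" using y i by (force simp: h_def)
  qed
  ultimately have "bij_betw h ?S ?S'" by (simp only: bij_betw_def)
  then have "card ?S = card ?S'" by (rule bij_betw_same_card)
  then show ?thesis
    unfolding inv_stat_eq_card_triples[OF lam F] by simp
qed

text \<open>The height difference of columns \<open>j\<close> and \<open>x\<close> starts at 0 and moves in unit steps, so the
  numbers of its steps from 0 to -1 and from -1 to 0 differ by at most one.\<close>

lemma crossings_balance:
  assumes "(0, j) \<notin> P" "(0, x) \<notin> P"
  shows "card {k \<in> {1..n}. (k, j) \<notin> P \<and> (k, x) \<in> P \<and> Suc (height P k j) = height P k x} =
    card {k \<in> {1..n}. (k, j) \<in> P \<and> (k, x) \<notin> P \<and> height P k j = height P k x} +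
    of_bool (height P n j < height P n x)"
proof (induction n)
  case 0
  then show ?case by (simp add: height_0 assms)
next
  case (Suc n)
  have split: "card {k \<in> {1..Suc n}. Q k} = card {k \<in> {1..n}. Q k} + of_bool (Q (Suc n))" for Q
  proof -
    have "{k \<in> {1..Suc n}. Q k} = {k \<in> {1..n}. Q k} \<union> (if Q (Suc n) then {Suc n} else {})"
      by (auto simp: le_Suc_eq)
    then show ?thesis by auto
  qed
  show ?case
    unfolding split using Suc.IH by (auto simp: height_Suc of_bool_def split: if_splits)
qed

text \<open>Regroups the count by pairs of columns, so that \<open>crossings_balance\<close> can be
  applied to each pair separately.\<close>

lemma card_triples_eq_sum:
  assumes "finite C"
  shows "card {(k, j, x). k \<in> {1..n :: nat} \<and> j \<in> C \<and> x \<in> C \<and> (j :: nat) < x \<and> Q k j x} =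
    (\<Sum>(j, x)\<in>{(j, x). j \<in> C \<and> x \<in> C \<and> j < x}. card {k \<in> {1..n}. Q k j x})"
proof -
  let ?A = "{(j, x). j \<in> C \<and> x \<in> C \<and> j < x}"
  let ?S = "Sigma ?A (\<lambda>(j, x). {k \<in> {1..n}. Q k j x})"
  have fin: "finite ?A" by (rule finite_subset[of _ "C \<times> C"]) (use assms in auto)
  have "{(k, j, x). k \<in> {1..n} \<and> j \<in> C \<and> x \<in> C \<and> j < x \<and> Q k j x} = (\<lambda>((j, x), k). (k, j, x)) ` ?S"
    by force
  moreover have "inj_on (\<lambda>((j, x), k). (k, j, x)) ?S" by (auto simp: inj_on_def)
  ultimately have "card {(k, j, x). k \<in> {1..n} \<and> j \<in> C \<and> x \<in> C \<and> j < x \<and> Q k j x} = card ?S"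
    by (simp add: card_image)
  also have "\<dots> = (\<Sum>p\<in>?A. card (case p of (j, x) \<Rightarrow> {k \<in> {1..n}. Q k j x}))"
    by (rule card_SigmaI) (use fin in auto)
  finally show ?thesis by (simp add: case_prod_beta)
qed

text \<open>A column is finally at least as high as any column to its right, so the boundary term of
  \<open>crossings_balance\<close> vanishes and overtakings are as many as returns. A return is a
  pair level after the step of which only the left column grew.\<close>

lemma inv_stat_eq_chain_inv:
  assumes lam: "is_partition lam" and F: "F \<in> CSF n lam"
  shows "inv_stat lam F = int (chain_inv (\<lambda>c. - int c) {1..lam 1} n (columns lam F))"
proof -
  let ?P = "columns lam F" and ?C = "{1..lam 1}"
  have z: "(0, c) \<notin> ?P" for c using columns_subset[OF lam F] by auto
  have "\<not> height ?P n j < height ?P n x" if "j \<in> ?C" "x \<in> ?C" "j < x" for j x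
  proof
    assume less: "height ?P n j < height ?P n x"
    have dg: "(height ?P n x, x) \<in> dg lam"
      using le_height_columns[OF lam F, of "height ?P n x" n x] less by simp
    then have "(height ?P n x, j) \<in> dg lam" by (rule dg_left) (use that in auto)
    then show False
      using le_height_columns[OF lam F, of "height ?P n x" n j] less CSF_range[OF F] by force
  qed
  then have "card {k \<in> {1..n}. (k, j) \<notin> ?P \<and> (k, x) \<in> ?P \<and> Suc (height ?P k j) = height ?P k x} =
      card {k \<in> {1..n}. (k, j) \<in> ?P \<and> (k, x) \<notin> ?P \<and> height ?P k j = height ?P k x}"
    if "j \<in> ?C" "x \<in> ?C" "j < x" for j x
    using crossings_balance[OF z z, where j = j and x = x and n = n] that by simp
  then have "card {(k, j, x). k \<in> {1..n} \<and> j \<in> ?C \<and> x \<in> ?C \<and> j < x \<and>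
       ((k, j) \<notin> ?P \<and> (k, x) \<in> ?P \<and> Suc (height ?P k j) = height ?P k x)} =
     card {(k, j, x). k \<in> {1..n} \<and> j \<in> ?C \<and> x \<in> ?C \<and> j < x \<and>
       ((k, j) \<in> ?P \<and> (k, x) \<notin> ?P \<and> height ?P k j = height ?P k x)}"
    unfolding card_triples_eq_sum[OF finite_atLeastAtMost] by (intro sum.cong) auto
  \<comment> \<open>Exchanging \<open>j\<close> and \<open>x\<close> puts the growing column second,
    as in \<open>chain_inv\<close>, and reverses the order of the columns.\<close>
  also have "\<dots> = card ((\<lambda>(k, j, x). (k, x, j)) ` {(k, j, x). k \<in> {1..n} \<and> j \<in> ?C \<and> x \<in> ?C \<and> j < x \<and>
       ((k, j) \<in> ?P \<and> (k, x) \<notin> ?P \<and> height ?P k j = height ?P k x)})"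
    by (rule card_image[symmetric]) (auto simp: inj_on_def)
  also have "(\<lambda>(k, j, x). (k, x, j)) ` {(k, j, x). k \<in> {1..n} \<and> j \<in> ?C \<and> x \<in> ?C \<and> j < x \<and>
       ((k, j) \<in> ?P \<and> (k, x) \<notin> ?P \<and> height ?P k j = height ?P k x)} =
     {(k, j, x). k \<in> {1..n} \<and> j \<in> ?C \<and> x \<in> ?C \<and> - int j < - int x \<and>
       (k, j) \<notin> ?P \<and> (k, x) \<in> ?P \<and> height ?P k j = height ?P k x}"
    by (auto simp: image_iff)
  finally show ?thesis
    unfolding inv_stat_eq_card_steps[OF lam F] chain_inv_eq_card[OF finite_atLeastAtMost] by simp
qed

theorem corollary4:
  fixes n :: nat and lam :: "nat \<Rightarrow> nat" and T :: pattern
  assumes "n \<ge> 1"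
    and "is_partition lam"
    and "num_parts lam \<le> n"
    and "T \<in> GT n lam"
  shows "(\<Sum>F\<in>rsort_fibre n lam T. qvar powi inv_stat lam F) =
           (\<Sum>F\<in>rsort_fibre n lam T. qvar powi quinv_stat lam F) \<and>
         (\<Sum>F\<in>rsort_fibre n lam T. qvar powi quinv_stat lam F) = wt_q n T \<and>
         (\<forall>F\<in>rsort_fibre n lam T. inv_stat lam F + quinv_stat lam F = area n T) \<and>
         (\<forall>F\<in>rsort_fibre n lam T. \<forall>G\<in>rsort_fibre n lam T.
            inv_stat lam F + quinv_stat lam F = inv_stat lam G + quinv_stat lam G)"
proof -
  note lam = assms(2)
  let ?C = "{1..lam 1}"
  have ext: "T \<in> extensional (gt_index n)"
    and top: "\<forall>i\<in>{1..n}. T (i, n) = int (lam i)"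
    and nonneg: "\<forall>i j. 1 \<le> i \<and> i \<le> j \<and> j < n \<longrightarrow> NE T i j \<ge> 0 \<and> SE T i j \<ge> 0"
    using assms(4) by (auto simp: GT_def)
  have fibre: "F \<in> CSF n lam" if "F \<in> rsort_fibre n lam T" for F
    using that by (simp add: rsort_fibre_def)
  have bij: "bij_betw (columns lam) (rsort_fibre n lam T) (height_chains n ?C (col_len lam) T)"
    by (rule bij_betw_columns[OF lam ext])
  \<comment> \<open>The bound on the number of parts enters here: no column is longer than
    \<open>n\<close>.\<close>
  have H: "\<forall>c\<in>?C. col_len lam c \<le> n"
  proof
    fix c assume "c \<in> ?C"
    then have "col_len lam c \<le> num_parts lam"
      unfolding col_len_def num_parts_def
      by (intro card_mono) (use lam in \<open>auto simp: is_partition_def\<close>)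
    then show "col_len lam c \<le> n" using assms(3) by simp
  qed
  \<comment> \<open>Conjugating twice gives back \<open>lam\<close>, which is the boundary
    \<open>T (i, n)\<close> of the pattern.\<close>
  have rows: "\<forall>i\<in>{1..n}. int (card {c \<in> ?C. i \<le> col_len lam c}) = T (i, n)"
  proof
    fix i assume i: "i \<in> {1..n}"
    have "i \<le> col_len lam c \<longleftrightarrow> c \<le> lam i" if "1 \<le> c" for c
      using dg_iff_col_len[OF lam, of i c] i that by (simp add: dg_def)
    moreover have "lam i \<le> lam 1"
      using partition_antimono[OF lam, of 1 i] i by simp
    ultimately have "{c \<in> ?C. i \<le> col_len lam c} = {1..lam i}"
      by fastforce
    then show "int (card {c \<in> ?C. i \<le> col_len lam c}) = T (i, n)"
      using top i by simp
  qed
  \<comment> \<open>One generating function for every injective order of the columns; the natural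
    and the reversed order give \<open>quinv\<close> and \<open>inv\<close>.\<close>
  have gen: "(\<Sum>F\<in>rsort_fibre n lam T. qvar ^ chain_inv f ?C n (columns lam F)) = wt_q n T"
    if "inj f" for f
    unfolding sum.reindex_bij_betw[OF bij, of "\<lambda>P. qvar ^ chain_inv f ?C n P"]
    by (rule sum_height_chains[OF _ that H rows nonneg]) simp
  have inj: "inj int" "inj (\<lambda>c. - int c)" by (auto intro: injI)
  \<comment> \<open>Once the statistic is a natural number, \<open>powi\<close> is an ordinary
    power.\<close>
  have quinv: "(\<Sum>F\<in>rsort_fibre n lam T. qvar powi quinv_stat lam F) = wt_q n T"
    using gen[OF inj(1)] by (simp add: quinv_stat_eq_chain_inv[OF lam fibre] cong: sum.cong)
  have inv: "(\<Sum>F\<in>rsort_fibre n lam T. qvar powi inv_stat lam F) = wt_q n T"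
    using gen[OF inj(2)] by (simp add: inv_stat_eq_chain_inv[OF lam fibre] cong: sum.cong)
  have area: "inv_stat lam F + quinv_stat lam F = area n T" if F: "F \<in> rsort_fibre n lam T" for F
  proof -
    have "columns lam F \<in> height_chains n ?C (col_len lam) T"
      using bij F by (auto simp: bij_betw_def)
    from chain_inv_add_chain_inv[OF _ inj(1) H rows this] show ?thesis
      by (simp add: quinv_stat_eq_chain_inv[OF lam fibre[OF F]] inv_stat_eq_chain_inv[OF lam fibre[OF F]])
  qed
  from inv quinv area show ?thesis by simp
qed

end
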